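(* Let $G$ be a finite simple $3$-connected cubic graph and let $x,y$ be two distinct vertices of $G$. If $x$ and $y$ are adjacent and $P$ is a longest $(x,y)$-path in $G$ (i.e., a path with endpoints $x$ and $y$ of maximum length among all such paths), then $P$ contains at least two internal $P$-bound vertices.
   Context: For a subgraph $H$ of a graph $G$, a vertex $v$ of $H$ is called $H$-bound if all neighbors of $v$ in $G$ lie in $H$, i.e., $N_G(v)\subseteq V(H)$. An internal vertex of a path is a vertex of the path that is not one of its endpoints. *)

theory Defs
  imports "Graph_Theory.Graph_Theory"
begin

text \<open>
  Undirected graphs are modelled as symmetric digraphs: a finite simple graph is a \<open>G\<close> with
  \<open>graph G\<close>, and each undirected edge is a pair of opposite arcs.  Hence the neighbours of a
  vertex are its out-neighbours and its degree is its out-degree.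
\<close>

definition nbrs :: "('a,'b) pre_digraph \<Rightarrow> 'a \<Rightarrow> 'a set" where
  "nbrs G v = {u. v \<rightarrow>\<^bsub>G\<^esub> u}"

definition cubic :: "('a,'b) pre_digraph \<Rightarrow> bool" where
  "cubic G \<longleftrightarrow> (\<forall>v \<in> verts G. out_degree G v = 3)"

definition k_connected :: "nat \<Rightarrow> ('a,'b) pre_digraph \<Rightarrow> bool" where
  "k_connected k G \<longleftrightarrow> k < card (verts G) \<and>
     (\<forall>S. S \<subseteq> verts G \<and> card S < k \<longrightarrow> connected (G \<restriction> (verts G - S)))"

text \<open>Paths are given by their vertex sequences.\<close>

definition path_between :: "('a,'b) pre_digraph \<Rightarrow> 'a \<Rightarrow> 'a \<Rightarrow> 'a vwalk \<Rightarrow> bool" where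
  "path_between G x y p \<longleftrightarrow> vpath p G \<and> hd p = x \<and> last p = y"

definition longest_path_between :: "('a,'b) pre_digraph \<Rightarrow> 'a \<Rightarrow> 'a \<Rightarrow> 'a vwalk \<Rightarrow> bool" where
  "longest_path_between G x y p \<longleftrightarrow> path_between G x y p \<and>
     (\<forall>q. path_between G x y q \<longrightarrow> vwalk_length q \<le> vwalk_length p)"

definition internal_verts :: "'a vwalk \<Rightarrow> 'a set" where
  "internal_verts p = set p - {hd p, last p}"

text \<open>The path as an undirected subgraph, that is, with both arcs of each of its edges.\<close>

definition path_subgraph :: "('a,'b) pre_digraph \<Rightarrow> 'a vwalk \<Rightarrow> ('a,'b) pre_digraph" where
  "path_subgraph G p = \<lparr> verts = set p,
     arcs = {e \<in> arcs G. arc_to_ends G e \<in> set (vwalk_arcs p) \<union> (set (vwalk_arcs p))\<inverse>},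
     tail = tail G, head = head G \<rparr>"

text \<open>\<open>bound_vertex G H v\<close>: the vertex \<open>v\<close> of the subgraph \<open>H\<close> of \<open>G\<close> is \<open>H\<close>-bound.\<close>

definition bound_vertex :: "('a,'b) pre_digraph \<Rightarrow> ('a,'b) pre_digraph \<Rightarrow> 'a \<Rightarrow> bool" where
  "bound_vertex G H v \<longleftrightarrow> v \<in> verts H \<and> nbrs G v \<subseteq> verts H"

lemma set_vwalk_arcs_subset: "(u, v) \<in> set (vwalk_arcs p) \<Longrightarrow> u \<in> set p \<and> v \<in> set p"
  by (induction p rule: vwalk_arcs.induct) auto

lemma subgraph_path_subgraph:
  assumes "graph G" "vpath p G"
  shows "subgraph (path_subgraph G p) G"
proof -
  interpret graph G by fact
  have "wf_digraph (path_subgraph G p)"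
    by unfold_locales
      (auto simp: path_subgraph_def arc_to_ends_def dest: set_vwalk_arcs_subset)
  then show ?thesis
    using assms(2) wf_digraph
    by (auto simp: subgraph_def compatible_def path_subgraph_def vpath_def vwalk_def)
qed

lemma graph_path_subgraph:
  assumes "graph G" "vpath p G"
  shows "graph (path_subgraph G p)"
proof -
  interpret graph G by fact
  have "symmetric (path_subgraph G p)"
    using sym_arcs
    unfolding symmetric_conv path_subgraph_def arc_to_ends_def
    by simp (metis)
  with subgraph_path_subgraph[OF assms] show ?thesis
    by unfold_locales
      (auto simp: path_subgraph_def arc_to_ends_def subgraph_def
        dest: wf_digraph.tail_in_verts wf_digraph.head_in_verts no_loops intro: no_multi_arcs)
qed

end

theory Submission
  imports Defs "HOL-Library.Z2"
begin

text \<open>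
  Adding the edge \<open>xy\<close> to \<open>P\<close> gives a cycle.  If \<open>P\<close> had at most one internal bound vertex, this
  cycle would have no chord, or a single one, joining \<open>x\<close> or \<open>y\<close> to an internal vertex.  By
  3-connectivity every component of \<open>G - P\<close> has at least three neighbours on \<open>P\<close>, and a parity
  argument on the homology of independence complexes of paths yields a set \<open>A\<close> of vertices of \<open>P\<close>, no
  two of them consecutive, containing one neighbour of each component.  Join every other vertex of
  \<open>P\<close> to the representative in \<open>A\<close> of its component.  Thomason's lollipop argument, applied as in
  Thomassen's work on chords of longest cycles, gives a second Hamiltonian cycle through \<open>xy\<close> in the
  resulting graph on \<open>V(P)\<close>.  Rerouting its new edges through the components loses a vertex of \<open>A\<close>
  only if two new edges meet there, in which case a vertex of the component replaces it; since some
  vertex of \<open>A\<close> is incident with exactly one new edge, the result is a path longer than \<open>P\<close>.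
  If there is a chord at \<open>x\<close>, the argument is applied to \<open>P - x\<close>, with \<open>A\<close> avoiding the neighbours on
  \<open>P\<close> of the other end of the chord.
\<close>

section \<open>Independent transversals on a path\<close>

text \<open>The components supply only three candidates each, while the general degree bound for
  independent transversals asks for classes of size four in a graph of maximum degree two. This is
  why topology enters: in the independence complex of a path, a cycle of k-vertex simplices can be
  filled as soon as 3k + 1 vertices are available. For n colours the simplices to be filled have n -
  1 vertices, so 3(n - 1) + 1 = 3n - 2 candidates are enough. Three attachments per component thus
  leave a slack of exactly 2, and this pays for the chord case, where up to two vertices next to the
  end of the chord are forbidden. The second obstacle is that the centres of the stars may have any
  degree, whereas the lollipop argument needs degree three at every possible end of a path.
  Non-consecutive centres allow a count of edges that keeps all ends away from them. Finally, a
  second cycle could have two new edges at every centre it changes and yield no gain; passing to a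
  minimal set of centres closed under the relevant adjacencies excludes this.\<close>

declare add_bit_eq_xor [simp del] mult_bit_eq_and [simp del]

section \<open>Simplicial chains modulo 2\<close>

lemma bit_add_self [simp]: "a + a = (0::bit)"
  by (cases a) simp_all

lemma bit_add_left_cancel2 [simp]: "a + (a + b) = (b::bit)"
  by (simp flip: add.assoc)

text \<open>Off the diagonal the terms cancel in pairs modulo 2. This is the common reason for
  boundaries having zero boundary and for the faces in the Sperner construction forming a
  cycle.\<close>

lemma sum_bit_symmetric:
  fixes h :: "'a \<Rightarrow> 'a \<Rightarrow> bit"
  assumes "finite F" "\<And>v w. h v w = h w v" "\<And>v. h v v = 0"
  shows "(\<Sum>v\<in>F. \<Sum>w\<in>F. h v w) = 0"
  using assms(1)
proof (induction F)
  case (insert x F)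
  have "(\<Sum>v\<in>insert x F. \<Sum>w\<in>insert x F. h v w)
      = (\<Sum>w\<in>F. h x w) + ((\<Sum>v\<in>F. h v x) + (\<Sum>v\<in>F. \<Sum>w\<in>F. h v w))"
    using insert.hyps by (simp add: assms(3) sum.distrib)
  also have "(\<Sum>v\<in>F. h v x) = (\<Sum>w\<in>F. h x w)"
    by (intro sum.cong refl assms(2))
  finally show ?case
    using insert.IH by simp
qed simp

text \<open>A chain is its coefficient function, so the coefficient at a face is collected from the
  simplices above it. The empty set counts as a simplex, which gives reduced homology.
  \<open>U\<close> is an ambient vertex set shared by chains on different subsets.\<close>

definition boundary :: "'a set \<Rightarrow> ('a set \<Rightarrow> bit) \<Rightarrow> 'a set \<Rightarrow> bit" where
  "boundary U S \<tau> = (\<Sum>v\<in>U - \<tau>. S (insert v \<tau>))"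

definition cone :: "'a \<Rightarrow> ('a set \<Rightarrow> bit) \<Rightarrow> 'a set \<Rightarrow> bit" where
  "cone v S \<sigma> = (if v \<in> \<sigma> then S (\<sigma> - {v}) else 0)"

definition link :: "'a \<Rightarrow> ('a set \<Rightarrow> bit) \<Rightarrow> 'a set \<Rightarrow> bit" where
  "link v S \<tau> = (if v \<in> \<tau> then 0 else S (insert v \<tau>))"

lemma boundary_add: "boundary U (\<lambda>\<sigma>. S \<sigma> + T \<sigma>) \<tau> = boundary U S \<tau> + boundary U T \<tau>"
  by (simp add: boundary_def sum.distrib)

lemma boundary_sum: "boundary U (\<lambda>\<sigma>. \<Sum>i\<in>I. S i \<sigma>) \<tau> = (\<Sum>i\<in>I. boundary U (S i) \<tau>)"
  unfolding boundary_def by (rule sum.swap)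

lemma boundary_boundary:
  assumes "finite U"
  shows "boundary U (boundary U S) \<tau> = 0"
proof -
  define h where "h v w = (if v = w then 0 else S (insert w (insert v \<tau>)))" for v w
  have "(\<Sum>w\<in>U - insert v \<tau>. S (insert w (insert v \<tau>))) = (\<Sum>w\<in>U - \<tau>. h v w)"
    if "v \<in> U - \<tau>" for v
    unfolding h_def using that assms by (intro sum.mono_neutral_cong_left) auto
  then have "boundary U (boundary U S) \<tau> = (\<Sum>v\<in>U - \<tau>. \<Sum>w\<in>U - \<tau>. h v w)"
    by (simp add: boundary_def)
  also have "\<dots> = 0"
    by (rule sum_bit_symmetric) (auto simp: assms h_def insert_commute)
  finally show ?thesis .
qed

text \<open>The cone is a contracting homotopy: the cone over a cycle has that cycle as its
  boundary. No support condition on \<open>S\<close> is imposed, since \<open>cone\<close> reads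
  only the values at sets without \<open>v\<close>.\<close>

lemma boundary_cone:
  assumes "finite U" "v \<in> U"
  shows "boundary U (cone v S) \<tau> = S \<tau> + cone v (boundary U S) \<tau>"
proof (cases "v \<in> \<tau>")
  case False
  have "boundary U (cone v S) \<tau> = (\<Sum>w\<in>U - \<tau>. if w = v then S \<tau> else 0)"
    unfolding boundary_def using False by (intro sum.cong) (auto simp: cone_def)
  also have "\<dots> = S \<tau>"
    using assms False by simp
  finally show ?thesis
    using False by (simp add: cone_def)
next
  case True
  have "boundary U S (\<tau> - {v}) = (\<Sum>w\<in>insert v (U - \<tau>). S (insert w (\<tau> - {v})))"
    unfolding boundary_def using assms True by (intro sum.cong) auto
  also have "\<dots> = S \<tau> + (\<Sum>w\<in>U - \<tau>. S (insert w (\<tau> - {v})))"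
    using assms True by (simp add: insert_absorb)
  also have "(\<Sum>w\<in>U - \<tau>. S (insert w (\<tau> - {v}))) = boundary U (cone v S) \<tau>"
    unfolding boundary_def using True
    by (intro sum.cong) (auto simp: cone_def insert_Diff_if)
  finally show ?thesis
    using True by (simp add: cone_def)
qed

text \<open>Used to see that links of cycles are again cycles; modulo 2 there is no sign.\<close>

lemma boundary_link:
  assumes "finite U" "v \<in> U"
  shows "boundary U (link v S) \<tau> = link v (boundary U S) \<tau>"
proof (cases "v \<in> \<tau>")
  case True
  then show ?thesis by (simp add: boundary_def link_def)
next
  case False
  have "boundary U (link v S) \<tau> = (\<Sum>w\<in>U - insert v \<tau>. S (insert w (insert v \<tau>)))"
    unfolding boundary_def using assms False
    by (intro sum.mono_neutral_cong_right) (auto simp: link_def insert_commute)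
  then show ?thesis
    using False by (simp add: link_def boundary_def)
qed

section \<open>Independence complexes of paths\<close>

definition indep :: "nat set \<Rightarrow> bool" where
  "indep \<sigma> \<longleftrightarrow> (\<forall>i\<in>\<sigma>. Suc i \<notin> \<sigma>)"

text \<open>\<open>k\<close> is the number of vertices of a simplex, one more than its dimension;
  \<open>k = 0\<close> is the degree of the empty simplex.\<close>

definition chain :: "nat set \<Rightarrow> nat \<Rightarrow> (nat set \<Rightarrow> bit) \<Rightarrow> bool" where
  "chain V k S \<longleftrightarrow> (\<forall>\<sigma>. S \<sigma> \<noteq> 0 \<longrightarrow> \<sigma> \<subseteq> V \<and> card \<sigma> = k \<and> indep \<sigma>)"

lemma chain_add: "chain V k S \<Longrightarrow> chain V k T \<Longrightarrow> chain V k (\<lambda>\<sigma>. S \<sigma> + T \<sigma>)"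
  unfolding chain_def by (metis add_0)

lemma chain_mono: "chain V k S \<Longrightarrow> V \<subseteq> W \<Longrightarrow> chain W k S"
  unfolding chain_def by blast

lemma chain_sum: "(\<And>i. i \<in> I \<Longrightarrow> chain V k (S i)) \<Longrightarrow> chain V k (\<lambda>\<sigma>. \<Sum>i\<in>I. S i \<sigma>)"
  unfolding chain_def by (meson sum.not_neutral_contains_not_neutral)

lemma chain_cone:
  assumes "finite V" "chain V k S" "v \<notin> V" "Suc v \<notin> V" "\<And>w. w \<in> V \<Longrightarrow> Suc w \<noteq> v"
  shows "chain (insert v V) (Suc k) (cone v S)"
  unfolding chain_def
proof (intro allI impI)
  fix \<sigma> assume "cone v S \<sigma> \<noteq> 0"
  then have "v \<in> \<sigma>" "S (\<sigma> - {v}) \<noteq> 0"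
    by (auto simp: cone_def split: if_splits)
  moreover from this have *: "\<sigma> - {v} \<subseteq> V" "card (\<sigma> - {v}) = k" "indep (\<sigma> - {v})"
    using assms(2) unfolding chain_def by blast+
  moreover have "finite (\<sigma> - {v})" using finite_subset[OF *(1) assms(1)] .
  ultimately have "card \<sigma> = Suc k"
    by (metis card_Suc_Diff1 finite_Diff_insert finite.emptyI finite_insert Diff_empty)
  moreover have "\<sigma> \<subseteq> insert v V" using * by blast
  moreover have "indep \<sigma>"
    unfolding indep_def
  proof (intro ballI notI)
    fix i assume i: "i \<in> \<sigma>" "Suc i \<in> \<sigma>"
    have V: "j \<in> V" if "j \<in> \<sigma>" "j \<noteq> v" for j
      using *(1) that by blast
    consider "i = v" | "Suc i = v" | "i \<noteq> v" "Suc i \<noteq> v" by blast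
    then show False
    proof cases
      case 1 then show False using V[OF i(2)] assms(4) by simp
    next
      case 2 then show False using V[OF i(1)] assms(5) by auto
    next
      case 3 then show False using i *(3) by (simp add: indep_def)
    qed
  qed
  ultimately show "\<sigma> \<subseteq> insert v V \<and> card \<sigma> = Suc k \<and> indep \<sigma>" by blast
qed

text \<open>
  With \<open>a\<close> the least vertex, a filling of the link of \<open>Suc a\<close> is used to push the cycle off \<open>Suc a\<close>; it
  is then the boundary of its cone with apex \<open>a\<close>.
\<close>

lemma cycle_is_boundary:
  assumes "finite U" "V \<subseteq> U" "chain V k S" "\<And>\<tau>. boundary U S \<tau> = 0" "3 * k + 1 \<le> card V"
  shows "\<exists>T. chain V (Suc k) T \<and> (\<forall>\<tau>. boundary U T \<tau> = S \<tau>)"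
  using assms(2-5)
proof (induction k arbitrary: V S)
  case 0
  then obtain v where v: "v \<in> V" by fastforce
  \<comment> \<open>Only the empty simplex can carry a coefficient here, so any single vertex serves
    as apex; this vertex is the \<open>+ 1\<close> in the bound.\<close>
  have "chain {} 0 S"
    using 0 assms(1) finite_subset unfolding chain_def by (metis card_0_eq finite_subset subset_refl)
  then have "chain {v} (Suc 0) (cone v S)"
    by (rule chain_cone[rotated]) auto
  moreover have "boundary U (cone v S) \<tau> = S \<tau>" for \<tau>
    using 0 v assms(1) by (subst boundary_cone) (auto simp: cone_def)
  ultimately show ?case
    using v by (intro exI[of _ "cone v S"]) (auto intro: chain_mono)
next
  case (Suc k)
  have finV: "finite V" using Suc.prems assms(1) finite_subset by blast
  define a where "a = Min V"
  have "V \<noteq> {}" using Suc.prems(4) by force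
  then have a: "a \<in> V" "\<And>w. w \<in> V \<Longrightarrow> a \<le> w"
    using finV by (auto simp: a_def)
  \<comment> \<open>The closed neighbourhood of \<open>Suc a\<close> is removed: three vertices for
    each dimension, whence the factor 3.\<close>
  define W where "W = V - {a, Suc a, Suc (Suc a)}"
  have "card V - card {a, Suc a, Suc (Suc a)} \<le> card W"
    unfolding W_def by (rule diff_card_le_card_Diff) simp
  then have cW: "3 * k + 1 \<le> card W"
    using Suc.prems(4) by simp
  have finW: "finite W" using finV by (simp add: W_def)
  \<comment> \<open>If \<open>Suc a\<close> is not in \<open>V\<close>, its link vanishes; the
    filling is then required to be zero, so that the cone at \<open>Suc a\<close> does not leave
    \<open>V\<close>.\<close>
  have "\<exists>T. chain W (Suc k) T \<and> (\<forall>\<tau>. boundary U T \<tau> = link (Suc a) S \<tau>) \<and> (Suc a \<notin> V \<longrightarrow> T = (\<lambda>_. 0))"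
  proof (cases "Suc a \<in> V")
    case False
    then have "link (Suc a) S \<tau> = 0" for \<tau>
      using Suc.prems(2) unfolding link_def chain_def by (metis insert_subset)
    then show ?thesis
      by (intro exI[of _ "\<lambda>_. 0"]) (auto simp: chain_def boundary_def)
  next
    case True
    have "chain W k (link (Suc a) S)"
      unfolding chain_def
    proof (intro allI impI)
      fix \<sigma> assume "link (Suc a) S \<sigma> \<noteq> 0"
      then have "Suc a \<notin> \<sigma>" "S (insert (Suc a) \<sigma>) \<noteq> 0" by (auto simp: link_def split: if_splits)
      then have *: "insert (Suc a) \<sigma> \<subseteq> V" "card (insert (Suc a) \<sigma>) = Suc k" "indep (insert (Suc a) \<sigma>)"
        using Suc.prems(2) unfolding chain_def by blast+
      have "finite \<sigma>" using finite_subset[OF *(1) finV] by simp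
      then have "card \<sigma> = k" using * \<open>Suc a \<notin> \<sigma>\<close> by simp
      moreover have "\<sigma> \<subseteq> W" using * \<open>Suc a \<notin> \<sigma>\<close> unfolding W_def indep_def by blast
      moreover have "indep \<sigma>" using * unfolding indep_def by blast
      ultimately show "\<sigma> \<subseteq> W \<and> card \<sigma> = k \<and> indep \<sigma>" by blast
    qed
    moreover have "boundary U (link (Suc a) S) \<tau> = 0" for \<tau>
      using True Suc.prems assms(1) by (subst boundary_link) (auto simp: link_def)
    ultimately show ?thesis
      using Suc.IH[of W "link (Suc a) S"] cW Suc.prems(1) True by (auto simp: W_def)
  qed
  then obtain T1 where T1: "chain W (Suc k) T1" "\<And>\<tau>. boundary U T1 \<tau> = link (Suc a) S \<tau>"
    "Suc a \<notin> V \<Longrightarrow> T1 = (\<lambda>_. 0)" by blast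
  have U1: "chain V (Suc (Suc k)) (cone (Suc a) T1)"
  proof (cases "Suc a \<in> V")
    case True
    have "chain (insert (Suc a) W) (Suc (Suc k)) (cone (Suc a) T1)"
      by (rule chain_cone) (use T1 finW W_def in auto)
    then show ?thesis by (rule chain_mono) (use True W_def in auto)
  next
    case False
    then show ?thesis using T1(3) by (auto simp: chain_def cone_def)
  qed
  \<comment> \<open>A cycle homologous to \<open>S\<close>. At a simplex through
    \<open>Suc a\<close> the cone over the link contributes the value of \<open>S\<close> itself, so
    the two cancel.\<close>
  define S1 where "S1 = (\<lambda>\<tau>. S \<tau> + boundary U (cone (Suc a) T1) \<tau>)"
  have S1_eq: "S1 \<tau> = S \<tau> + (T1 \<tau> + cone (Suc a) (link (Suc a) S) \<tau>)" for \<tau>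
  proof (cases "Suc a \<in> V")
    case True
    then have "Suc a \<in> U" using Suc.prems by auto
    then show ?thesis
      using assms(1) T1(2) by (simp add: S1_def boundary_cone cone_def)
  next
    case False
    then have "T1 = (\<lambda>_. 0)" "link (Suc a) S = (\<lambda>_. 0)"
      using T1(2,3) by (auto simp: boundary_def fun_eq_iff)
    then show ?thesis by (simp add: S1_def boundary_def cone_def)
  qed
  \<comment> \<open>Simplices through \<open>a\<close> are erased because \<open>cone a\<close>
    ignores them. With \<open>Suc a\<close> gone and \<open>a\<close> least, no neighbour of
    \<open>a\<close> remains, so coning with apex \<open>a\<close> keeps independence.\<close>
  have S1: "chain (V - {a, Suc a}) (Suc k) (\<lambda>\<sigma>. if a \<in> \<sigma> then 0 else S1 \<sigma>)"
    unfolding chain_def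
  proof (intro allI impI)
    fix \<sigma> assume "(if a \<in> \<sigma> then 0 else S1 \<sigma>) \<noteq> 0"
    then have as: "a \<notin> \<sigma>" and "S1 \<sigma> \<noteq> 0" by (auto split: if_splits)
    have sa: "Suc a \<notin> \<sigma>"
    proof
      assume *: "Suc a \<in> \<sigma>"
      then have "T1 \<sigma> = 0"
        using T1(1) unfolding chain_def W_def by blast
      then show False
        using \<open>S1 \<sigma> \<noteq> 0\<close> * by (simp add: S1_eq cone_def link_def insert_absorb)
    qed
    then have "S1 \<sigma> = S \<sigma> + T1 \<sigma>" by (simp add: S1_eq cone_def)
    with \<open>S1 \<sigma> \<noteq> 0\<close> have "S \<sigma> \<noteq> 0 \<or> T1 \<sigma> \<noteq> 0" by auto
    then have "\<sigma> \<subseteq> V \<and> card \<sigma> = Suc k \<and> indep \<sigma>"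
      using Suc.prems(2) T1(1) unfolding chain_def W_def by (metis Diff_subset subset_trans)
    then show "\<sigma> \<subseteq> V - {a, Suc a} \<and> card \<sigma> = Suc k \<and> indep \<sigma>"
      using as sa by blast
  qed
  have "chain (insert a (V - {a, Suc a})) (Suc (Suc k)) (cone a (\<lambda>\<sigma>. if a \<in> \<sigma> then 0 else S1 \<sigma>))"
    by (rule chain_cone) (use S1 finV a(1) in \<open>auto dest: a(2)\<close>)
  moreover have "cone a (\<lambda>\<sigma>. if a \<in> \<sigma> then 0 else S1 \<sigma>) = cone a S1"
    by (auto simp: cone_def fun_eq_iff)
  ultimately have U2: "chain V (Suc (Suc k)) (cone a S1)"
    using chain_mono[of _ _ "cone a S1" V] a(1) by auto
  have "boundary U S1 \<tau> = 0" for \<tau>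
    unfolding S1_def using Suc.prems(3) boundary_boundary[OF assms(1)] by (simp add: boundary_add)
  then have "boundary U (cone a S1) \<tau> = S1 \<tau>" for \<tau>
    using subsetD[OF Suc.prems(1) a(1)] assms(1) by (simp add: boundary_cone cone_def)
  then have "boundary U (\<lambda>\<sigma>. cone (Suc a) T1 \<sigma> + cone a S1 \<sigma>) \<tau> = S \<tau>" for \<tau>
    by (simp add: boundary_add) (simp add: S1_def add.left_commute)
  with chain_add[OF U1 U2] show ?case by blast
qed

text \<open>The counting step of Sperner's lemma. From a full transversal only the vertex of colour
  \<open>i\<close> can be removed; otherwise a suitable removal exists only if one colour is
  repeated, and then exactly the two vertices of that colour qualify.\<close>

lemma transversal_removal_parity:
  assumes "finite \<sigma>" "finite I" "card \<sigma> = card I" "col ` \<sigma> \<subseteq> I" "i \<in> I"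
  shows "of_nat (card {v \<in> \<sigma>. col ` (\<sigma> - {v}) = I - {i}}) = (if col ` \<sigma> = I then 1 else (0::bit))"
proof (cases "col ` \<sigma> = I")
  case True
  then have inj: "inj_on col \<sigma>"
    using assms by (intro eq_card_imp_inj_on) auto
  obtain u where u: "u \<in> \<sigma>" "col u = i" using True assms(5) by auto
  have "col ` (\<sigma> - {v}) = I - {col v}" if "v \<in> \<sigma>" for v
    using inj that True by (auto simp: inj_on_def)
  then have "{v \<in> \<sigma>. col ` (\<sigma> - {v}) = I - {i}} = {v \<in> \<sigma>. I - {col v} = I - {i}}"
    by auto
  also have "\<dots> = {u}"
    using u inj assms(4,5) by (auto simp: inj_on_def)
  finally show ?thesis using True by simp
next
  case False
  have "even (card {v \<in> \<sigma>. col ` (\<sigma> - {v}) = I - {i}})"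
  proof (cases "\<exists>v\<in>\<sigma>. col ` (\<sigma> - {v}) = I - {i}")
    case True
    then obtain v where v: "v \<in> \<sigma>" "col ` (\<sigma> - {v}) = I - {i}" by blast
    have "card (\<sigma> - {v}) = card (I - {i})" using v assms by simp
    then have inj: "inj_on col (\<sigma> - {v})"
      using assms(1) v(2) by (intro eq_card_imp_inj_on) auto
    have "col v \<noteq> i"
    proof
      assume "col v = i"
      then have "col ` \<sigma> = I" using v assms(5) by (metis image_insert insert_Diff)
      with False show False ..
    qed
    then have "col v \<in> col ` (\<sigma> - {v})" using v assms(4) by auto
    then obtain w where w: "w \<in> \<sigma>" "w \<noteq> v" "col w = col v" by force
    have "{v \<in> \<sigma>. col ` (\<sigma> - {v}) = I - {i}} = {v, w}"
    proof (intro equalityI subsetI)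
      fix x assume x: "x \<in> {v \<in> \<sigma>. col ` (\<sigma> - {v}) = I - {i}}"
      show "x \<in> {v, w}"
      proof (rule ccontr)
        assume "x \<notin> {v, w}"
        then have "col x \<in> col ` (\<sigma> - {v})" using x by auto
        then have "col x \<in> col ` (\<sigma> - {x})" using x v by simp
        then obtain y where y: "y \<in> \<sigma>" "y \<noteq> x" "col y = col x" by force
        define y' where "y' = (if y = v then w else y)"
        have "y' \<in> \<sigma> - {v}" "y' \<noteq> x" "col y' = col x" "x \<in> \<sigma> - {v}"
          using y w x \<open>x \<notin> {v, w}\<close> by (auto simp: y'_def)
        then show False using inj by (auto simp: inj_on_def)
      qed
    next
      fix x assume "x \<in> {v, w}"
      moreover have "col ` (\<sigma> - {w}) = col ` (\<sigma> - {v})"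
      proof -
        have "\<sigma> - {w} = insert v (\<sigma> - {v, w})" "\<sigma> - {v} = insert w (\<sigma> - {v, w})"
          using v w by auto
        then show ?thesis using w(3) by (metis image_insert)
      qed
      ultimately show "x \<in> {v \<in> \<sigma>. col ` (\<sigma> - {v}) = I - {i}}" using v w by auto
    qed
    then show ?thesis using w(2) by simp
  next
    case False
    then have "{v \<in> \<sigma>. col ` (\<sigma> - {v}) = I - {i}} = {}" by blast
    then show ?thesis by (simp only: card.empty dvd_0_right)
  qed
  then show ?thesis using False by (auto elim!: evenE)
qed

text \<open>Double counting of the pairs of a simplex and a vertex whose removal leads into
  \<open>X\<close>.\<close>

lemma sum_boundary:
  assumes "finite U" "X \<subseteq> Pow U"
  shows "(\<Sum>\<tau>\<in>X. boundary U S \<tau>) = (\<Sum>\<sigma>\<in>Pow U. of_nat (card {v \<in> \<sigma>. \<sigma> - {v} \<in> X}) * S \<sigma>)"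
proof -
  have fin: "finite X" "\<And>\<sigma>. \<sigma> \<in> Pow U \<Longrightarrow> finite \<sigma>"
    using assms finite_subset by (blast, auto intro: finite_subset)
  have "(\<Sum>\<tau>\<in>X. boundary U S \<tau>) = (\<Sum>(\<tau>, v)\<in>Sigma X (\<lambda>\<tau>. U - \<tau>). S (insert v \<tau>))"
    unfolding boundary_def using assms fin by (subst sum.Sigma) auto
  also have "\<dots> = (\<Sum>(\<sigma>, v)\<in>Sigma (Pow U) (\<lambda>\<sigma>. {v \<in> \<sigma>. \<sigma> - {v} \<in> X}). S \<sigma>)"
    using assms
    by (intro sum.reindex_bij_witness[of _ "\<lambda>(\<sigma>, v). (\<sigma> - {v}, v)" "\<lambda>(\<tau>, v). (insert v \<tau>, v)"])
      (auto simp: insert_absorb)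
  also have "\<dots> = (\<Sum>\<sigma>\<in>Pow U. \<Sum>v\<in>{v \<in> \<sigma>. \<sigma> - {v} \<in> X}. S \<sigma>)"
    using assms fin by (subst sum.Sigma) auto
  finally show ?thesis by simp
qed

text \<open>These chains replace the triangulated simplex of Sperner's lemma: the face with colour
  set \<open>I\<close> uses only vertices with colours in \<open>I\<close>, and its boundary is the
  sum of its facets. They are built by increasing number of colours, each one filling the cycle
  formed by its facets; \<open>m\<close> bounds the stage reached.\<close>

lemma sperner_chain_family:
  fixes col :: "nat \<Rightarrow> 'k"
  assumes "finite V" "finite K" "\<And>I. I \<subseteq> K \<Longrightarrow> 3 * card I \<le> card {v \<in> V. col v \<in> I} + 2"
  shows "\<exists>c. c {} = (\<lambda>\<sigma>. if \<sigma> = {} then 1 else 0) \<and>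
    (\<forall>I. I \<subseteq> K \<and> card I \<le> m \<longrightarrow> chain {v \<in> V. col v \<in> I} (card I) (c I) \<and>
      (\<forall>\<tau>. boundary V (c I) \<tau> = (\<Sum>i\<in>I. c (I - {i}) \<tau>)))"
proof (induction m)
  case 0
  show ?case
    using finite_subset[OF _ assms(2)]
    by (intro exI[of _ "\<lambda>_ \<sigma>. if \<sigma> = {} then 1 else 0"])
      (auto simp: chain_def indep_def boundary_def)
next
  case (Suc m)
  then obtain c where c0: "c {} = (\<lambda>\<sigma>. if \<sigma> = {} then 1 else 0)"
    and c': "\<forall>I. I \<subseteq> K \<and> card I \<le> m \<longrightarrow> chain {v \<in> V. col v \<in> I} (card I) (c I) \<and>
      (\<forall>\<tau>. boundary V (c I) \<tau> = (\<Sum>i\<in>I. c (I - {i}) \<tau>))"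
    by (elim exE conjE)
  have c: "chain {v \<in> V. col v \<in> I} (card I) (c I)"
    "boundary V (c I) \<tau> = (\<Sum>i\<in>I. c (I - {i}) \<tau>)" if "I \<subseteq> K" "card I \<le> m" for I \<tau>
    using c'[rule_format, OF conjI[OF that]] by simp_all
  have ex: "\<exists>T. chain {v \<in> V. col v \<in> I} (Suc m) T \<and> (\<forall>\<tau>. boundary V T \<tau> = (\<Sum>i\<in>I. c (I - {i}) \<tau>))"
    if I: "I \<subseteq> K" "card I = Suc m" for I
  proof (rule cycle_is_boundary)
    have finI: "finite I" using I card_ge_0_finite by force
    have sub: "card (I - {i}) = m" "I - {i} \<subseteq> K" if "i \<in> I" for i
      using that I finI by auto
    show "chain {v \<in> V. col v \<in> I} m (\<lambda>\<sigma>. \<Sum>i\<in>I. c (I - {i}) \<sigma>)"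
    proof (rule chain_sum)
      fix i assume "i \<in> I"
      then have "chain {v \<in> V. col v \<in> I - {i}} m (c (I - {i}))"
        using c(1)[of "I - {i}"] sub by auto
      then show "chain {v \<in> V. col v \<in> I} m (c (I - {i}))" by (rule chain_mono) auto
    qed
    show "boundary V (\<lambda>\<sigma>. \<Sum>i\<in>I. c (I - {i}) \<sigma>) \<tau> = 0" for \<tau>
    proof -
      \<comment> \<open>The face lacking the colours \<open>i\<close> and \<open>j\<close> arises
        twice, once from each facet, so the total vanishes modulo 2.\<close>
      define h where "h i j = (if i = j then 0 else c (I - {i} - {j}) \<tau>)" for i j
      have "boundary V (c (I - {i})) \<tau> = (\<Sum>j\<in>I. h i j)" if "i \<in> I" for i
        using that sub[OF that] finI c(2)[of "I - {i}" \<tau>]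
        by (simp, intro sum.mono_neutral_cong_left) (auto simp: h_def)
      then have "boundary V (\<lambda>\<sigma>. \<Sum>i\<in>I. c (I - {i}) \<sigma>) \<tau> = (\<Sum>i\<in>I. \<Sum>j\<in>I. h i j)"
        by (simp add: boundary_sum)
      also have "\<dots> = 0"
      proof (rule sum_bit_symmetric)
        have "I - {i} - {j} = I - {j} - {i}" for i j by blast
        then show "h i j = h j i" for i j by (simp add: h_def)
      qed (simp_all add: finI h_def)
      finally show ?thesis .
    qed
    \<comment> \<open>The \<open>+ 2\<close> in the hypothesis is used up exactly here, as
      \<open>card I = Suc m\<close>.\<close>
    show "3 * m + 1 \<le> card {v \<in> V. col v \<in> I}" using assms(3)[OF I(1)] I(2) by simp
  qed (use assms(1) in auto)
  define T where "T I = (SOME T. chain {v \<in> V. col v \<in> I} (Suc m) T \<and>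
    (\<forall>\<tau>. boundary V T \<tau> = (\<Sum>i\<in>I. c (I - {i}) \<tau>)))" for I
  have T: "chain {v \<in> V. col v \<in> I} (Suc m) (T I) \<and> (\<forall>\<tau>. boundary V (T I) \<tau> = (\<Sum>i\<in>I. c (I - {i}) \<tau>))"
    if "I \<subseteq> K" "card I = Suc m" for I
    unfolding T_def using ex[OF that] by (rule someI_ex)
  define d where "d I = (if card I = Suc m then T I else c I)" for I
  have d_sub: "d (I - {i}) = c (I - {i})" if "I \<subseteq> K" "card I \<le> Suc m" "i \<in> I" for I i
    using that finite_subset[OF that(1) assms(2)] card_Diff1_less[of I i] by (simp add: d_def)
  show ?case
  proof (intro exI[of _ d] conjI allI impI)
    show "d {} = (\<lambda>\<sigma>. if \<sigma> = {} then 1 else 0)" by (simp add: d_def c0)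
  next
    fix I assume I: "I \<subseteq> K \<and> card I \<le> Suc m"
    show "chain {v \<in> V. col v \<in> I} (card I) (d I)"
      using I T[of I] c(1)[of I] by (auto simp: d_def)
    fix \<tau>
    have "boundary V (d I) \<tau> = (\<Sum>i\<in>I. c (I - {i}) \<tau>)"
      using I T[of I] c(2)[of I] by (auto simp: d_def)
    then show "boundary V (d I) \<tau> = (\<Sum>i\<in>I. d (I - {i}) \<tau>)"
      using I d_sub by simp
  qed
qed

text \<open>Sperner's lemma: the number modulo 2 of transversals in the chain of \<open>I\<close> is that for \<open>I - {i}\<close>.\<close>

theorem independent_transversal_path:
  fixes col :: "nat \<Rightarrow> 'k"
  assumes "finite V" "finite K" "\<And>I. I \<subseteq> K \<Longrightarrow> 3 * card I \<le> card {v \<in> V. col v \<in> I} + 2"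
  obtains A where "A \<subseteq> V" "indep A" "bij_betw col A K"
proof -
  obtain c where c0: "c {} = (\<lambda>\<sigma>. if \<sigma> = {} then 1 else 0)"
    and c': "\<forall>I. I \<subseteq> K \<and> card I \<le> card K \<longrightarrow> chain {v \<in> V. col v \<in> I} (card I) (c I) \<and>
      (\<forall>\<tau>. boundary V (c I) \<tau> = (\<Sum>i\<in>I. c (I - {i}) \<tau>))"
  proof -
    have "\<exists>c. c {} = (\<lambda>\<sigma>. if \<sigma> = {} then 1 else 0) \<and>
      (\<forall>I. I \<subseteq> K \<and> card I \<le> card K \<longrightarrow> chain {v \<in> V. col v \<in> I} (card I) (c I) \<and>
        (\<forall>\<tau>. boundary V (c I) \<tau> = (\<Sum>i\<in>I. c (I - {i}) \<tau>)))"
      by (rule sperner_chain_family[OF assms])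
    then show thesis using that by (elim exE conjE)
  qed
  have c: "chain {v \<in> V. col v \<in> I} (card I) (c I)"
    "boundary V (c I) \<tau> = (\<Sum>i\<in>I. c (I - {i}) \<tau>)" if "I \<subseteq> K" for I \<tau>
    using c'[rule_format, OF conjI[OF that card_mono[OF assms(2) that]]] by simp_all
  define r where "r I = (\<Sum>\<sigma>\<in>{\<sigma> \<in> Pow V. col ` \<sigma> = I}. c I \<sigma>)" for I
  have support: "finite \<sigma> \<and> card \<sigma> = card I \<and> col ` \<sigma> \<subseteq> I"
    if "I \<subseteq> K" "c I \<sigma> \<noteq> 0" for I \<sigma>
    using c(1)[OF that(1)] that(2) finite_subset[OF _ assms(1)] unfolding chain_def by blast
  have step: "r I = r (I - {i})" if I: "I \<subseteq> K" "i \<in> I" for I i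
  proof -
    have finI: "finite I" using I finite_subset assms(2) by blast
    define X where "X = {\<tau> \<in> Pow V. col ` \<tau> = I - {i}}"
    have finX: "finite X" using assms(1) by (simp add: X_def)
    have "(\<Sum>\<tau>\<in>X. boundary V (c I) \<tau>) = (\<Sum>\<sigma>\<in>Pow V. of_nat (card {v \<in> \<sigma>. \<sigma> - {v} \<in> X}) * c I \<sigma>)"
      by (rule sum_boundary) (auto simp: X_def assms(1))
    also have "\<dots> = (\<Sum>\<sigma>\<in>Pow V. if col ` \<sigma> = I then c I \<sigma> else 0)"
    proof (rule sum.cong[OF refl])
      fix \<sigma> assume \<sigma>: "\<sigma> \<in> Pow V"
      show "of_nat (card {v \<in> \<sigma>. \<sigma> - {v} \<in> X}) * c I \<sigma> = (if col ` \<sigma> = I then c I \<sigma> else 0)"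
      proof (cases "c I \<sigma> = 0")
        case False
        have "{v \<in> \<sigma>. \<sigma> - {v} \<in> X} = {v \<in> \<sigma>. col ` (\<sigma> - {v}) = I - {i}}"
          using \<sigma> by (auto simp: X_def)
        then show ?thesis
          using transversal_removal_parity[of \<sigma> I col i] support[OF I(1) False] finI I(2) by simp
      qed simp
    qed
    also have "\<dots> = r I"
      unfolding r_def by (rule sum.inter_filter[symmetric]) (simp add: assms(1))
    finally have "r I = (\<Sum>\<tau>\<in>X. \<Sum>j\<in>I. c (I - {j}) \<tau>)"
      using c(2)[OF I(1)] by simp
    also have "\<dots> = (\<Sum>j\<in>I. \<Sum>\<tau>\<in>X. c (I - {j}) \<tau>)"
      by (rule sum.swap)
    also have "\<dots> = (\<Sum>j\<in>I. if j = i then r (I - {i}) else 0)"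
    proof (rule sum.cong[OF refl])
      fix j assume j: "j \<in> I"
      show "(\<Sum>\<tau>\<in>X. c (I - {j}) \<tau>) = (if j = i then r (I - {i}) else 0)"
      proof (cases "j = i")
        case True
        then show ?thesis by (simp add: r_def X_def)
      next
        case False
        \<comment> \<open>For \<open>j \<noteq> i\<close> the sets in \<open>X\<close> use the
          colour \<open>j\<close>, which no simplex of this facet has; only the facet opposite to
          \<open>i\<close> survives.\<close>
        have "c (I - {j}) \<tau> = 0" if "\<tau> \<in> X" for \<tau>
        proof (rule ccontr)
          assume "c (I - {j}) \<tau> \<noteq> 0"
          then have "col ` \<tau> \<subseteq> I - {j}" using support[of "I - {j}" \<tau>] I(1) by blast
          moreover have "j \<in> col ` \<tau>" using that False j by (simp add: X_def)
          ultimately show False by blast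
        qed
        then show ?thesis using False by simp
      qed
    qed
    also have "\<dots> = r (I - {i})" using I finI by simp
    finally show ?thesis .
  qed
  have "r I = 1" if "finite I" "I \<subseteq> K" for I
    using that
  proof (induction I)
    case empty
    have "{\<sigma> \<in> Pow V. col ` \<sigma> = {}} = {{}}" by auto
    then show ?case by (simp add: r_def c0)
  next
    case (insert i I)
    then show ?case using step[of "insert i I" i] by simp
  qed
  then have "r K \<noteq> 0" using assms(2) by simp
  then obtain A where A: "col ` A = K" "c K A \<noteq> 0" "A \<subseteq> V"
    unfolding r_def by (smt (verit) mem_Collect_eq sum.not_neutral_contains_not_neutral PowD)
  then have "card A = card K" "indep A"
    using c(1)[of K] unfolding chain_def by auto
  then have "inj_on col A"
    using A assms(1) by (intro eq_card_imp_inj_on) (auto intro: finite_subset)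
  then show thesis using that A \<open>indep A\<close> by (simp add: bij_betw_def)
qed

section \<open>Lollipop parity argument\<close>

lemma even_card_involution:
  assumes "finite Z" "\<And>x. x \<in> Z \<Longrightarrow> f x \<in> Z \<and> f (f x) = x \<and> f x \<noteq> x"
  shows "even (card Z)"
  using assms
proof (induction "card Z" arbitrary: Z rule: less_induct)
  case less
  show ?case
  proof (cases "Z = {}")
    case False
    then obtain x where x: "x \<in> Z" by blast
    define Y where "Y = Z - {x, f x}"
    have fx: "f x \<in> Z" "f (f x) = x" "f x \<noteq> x" using less.prems(2)[OF x] by auto
    have card: "card Z = Suc (Suc (card Y))"
    proof -
      have "Z = insert x (insert (f x) Y)" "x \<notin> insert (f x) Y" "f x \<notin> Y" "finite Y"
        using x fx less.prems(1) by (auto simp: Y_def)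
      then show ?thesis by simp
    qed
    have "f y \<in> Y \<and> f (f y) = y \<and> f y \<noteq> y" if "y \<in> Y" for y
      using that less.prems(2)[of y] fx unfolding Y_def by auto
    then have "even (card Y)"
      using less.hyps[of Y] card less.prems(1) by (simp add: Y_def)
    then show ?thesis using card by simp
  qed simp
qed

text \<open>The first edge is prescribed along with the starting vertex, as the lollipop argument
  keeps it fixed.\<close>

definition ham_paths :: "('v \<Rightarrow> 'v \<Rightarrow> bool) \<Rightarrow> 'v set \<Rightarrow> 'v \<Rightarrow> 'v \<Rightarrow> 'v list set" where
  "ham_paths E V u v = {Q. distinct Q \<and> set Q = V \<and> successively E Q \<and> Q ! 0 = u \<and> Q ! 1 = v}"

text \<open>The lollipop move: the edge leaving position \<open>i\<close> is exchanged for one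
  joining position \<open>i\<close> to the last vertex, so the tail is traversed backwards.\<close>

definition pivot :: "nat \<Rightarrow> 'v list \<Rightarrow> 'v list" where
  "pivot i Q = take (Suc i) Q @ rev (drop (Suc i) Q)"

lemma pivot_pivot: "i < length Q \<Longrightarrow> pivot i (pivot i Q) = Q"
  by (simp add: pivot_def min_def)

lemma last_pivot: "Suc i < length Q \<Longrightarrow> last (pivot i Q) = Q ! Suc i"
  by (simp add: pivot_def last_rev hd_drop_conv_nth)

lemma nth_pivot: "i < length Q \<Longrightarrow> j \<le> i \<Longrightarrow> pivot i Q ! j = Q ! j"
  by (simp add: pivot_def nth_append)

lemma pivot_in_ham_paths:
  assumes "symp E" "Q \<in> ham_paths E V u v" "1 \<le> i" "Suc i < length Q" "E (last Q) (Q ! i)"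
  shows "pivot i Q \<in> ham_paths E V u v"
proof -
  have Q: "distinct Q" "set Q = V" "successively E Q" "Q ! 0 = u" "Q ! 1 = v"
    using assms(2) by (auto simp: ham_paths_def)
  have sw: "(\<lambda>x y. E y x) = E" using assms(1) by (auto simp: symp_def fun_eq_iff)
  have split: "take (Suc i) Q @ drop (Suc i) Q = Q" by simp
  have "successively E (take (Suc i) Q)" "successively E (drop (Suc i) Q)"
    using Q(3) successively_append_iff[of E "take (Suc i) Q" "drop (Suc i) Q"] by simp_all
  moreover have "last (take (Suc i) Q) = Q ! i"
    using assms(4) by (simp add: take_Suc_conv_app_nth)
  moreover have "hd (rev (drop (Suc i) Q)) = last Q"
    using assms(4) by (simp add: hd_rev last_drop)
  moreover have "successively E (rev (drop (Suc i) Q))"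
    using \<open>successively E (drop (Suc i) Q)\<close> by (simp only: successively_rev sw)
  moreover have "E (Q ! i) (last Q)" using assms(1,5) by (simp add: symp_def)
  ultimately have "successively E (pivot i Q)"
    by (auto simp: pivot_def successively_append_iff)
  moreover have "distinct (pivot i Q)" 
    using Q(1) distinct_append[of "take (Suc i) Q" "drop (Suc i) Q"] by (simp add: pivot_def)
  moreover have "set (pivot i Q) = V"
    using Q(2) set_append[of "take (Suc i) Q" "drop (Suc i) Q"] by (simp add: pivot_def)
  ultimately show ?thesis
    using Q assms(3,4) by (simp add: ham_paths_def nth_pivot)
qed

text \<open>A lollipop move can be undone at the same position, so the pairs of a path and a
  possible move are even in number. At the end of a path one of the three edges is its last edge;
  each of the other two allows a move or closes a cycle. Hence moves and closings add up to twice
  the number of paths. Only ends of such paths need degree three.\<close>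

lemma even_closing_ham_paths:
  assumes "finite V" "3 \<le> card V" "symp E" "\<And>x. \<not> E x x"
    and deg: "\<And>Q. Q \<in> ham_paths E V u v \<Longrightarrow> card {x \<in> V. E (last Q) x} = 3"
  shows "even (card {Q \<in> ham_paths E V u v. E (last Q) u})"
proof -
  let ?P = "ham_paths E V u v"
  define n where "n = card V"
  \<comment> \<open>Position \<open>n - 2\<close> precedes the end and gives no move; position 0
    would close the path into a cycle.\<close>
  define J where "J Q = {i. 1 \<le> i \<and> i + 2 < n \<and> E (last Q) (Q ! i)}" for Q
  have finP: "finite ?P"
    by (rule finite_subset[OF _ finite_subset_distinct[OF assms(1)]]) (auto simp: ham_paths_def)
  have finJ: "finite (J Q)" for Q
    by (rule finite_subset[of _ "{..<n}"]) (auto simp: J_def)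
  have len: "length Q = n" if "Q \<in> ?P" for Q
    using that distinct_card[of Q] by (auto simp: ham_paths_def n_def)
  have n3: "3 \<le> n" using assms(2) by (simp add: n_def)
  have cardJ: "card (J Q) + (if E (last Q) u then 1 else 0) = 2" if "Q \<in> ?P" for Q
  proof -
    have Q: "distinct Q" "set Q = V" "successively E Q" "Q ! 0 = u"
      using that by (auto simp: ham_paths_def)
    have last: "last Q = Q ! (n - 1)"
      using len[OF that] n3 by (metis last_conv_nth list.size(3) not_numeral_le_zero)
    have pred: "E (last Q) (Q ! (n - 2))"
    proof -
      have "Suc (n - 2) = n - 1" using n3 by simp
      then have "E (Q ! (n - 2)) (Q ! (n - 1))"
        using Q(3) len[OF that] n3 by (metis One_nat_def diff_less less_le_trans successively_nth zero_less_numeral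
            lessI zero_less_Suc numeral_3_eq_3)
      then show ?thesis using assms(3) last by (auto simp: symp_def)
    qed
    have "{x \<in> V. E (last Q) x} = (!) Q ` {i. i < n \<and> E (last Q) (Q ! i)}"
      using Q(2) len[OF that] by (auto simp: set_conv_nth)
    moreover have "inj_on ((!) Q) {i. i < n \<and> E (last Q) (Q ! i)}"
      using Q(1) len[OF that] by (auto simp: inj_on_def nth_eq_iff_index_eq)
    ultimately have "card {i. i < n \<and> E (last Q) (Q ! i)} = 3"
      using deg[OF that] by (simp add: card_image)
    moreover have "{i. i < n \<and> E (last Q) (Q ! i)}
        = insert (n - 2) (J Q \<union> (if E (last Q) u then {0} else {}))"
    proof -
      have "i = 0 \<or> 1 \<le> i \<and> i + 2 < n \<or> i = n - 2 \<or> i = n - 1" if "i < n" for i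
        using that by linarith
      then show ?thesis using assms(4) pred Q(4) n3 last by (auto simp: J_def)
    qed
    moreover have "n - 2 \<notin> J Q \<union> (if E (last Q) u then {0} else {})" "0 \<notin> J Q"
      using n3 by (auto simp: J_def)
    ultimately show ?thesis using finJ[of Q] by (auto split: if_splits)
  qed
  define Z where "Z = Sigma ?P J"
  have "even (card Z)"
  proof (rule even_card_involution)
    show "finite Z" using finP finJ by (simp add: Z_def)
    fix p assume "p \<in> Z"
    then obtain Q i where p: "p = (Q, i)" "Q \<in> ?P" "1 \<le> i" "i + 2 < n" "E (last Q) (Q ! i)"
      by (auto simp: Z_def J_def)
    have iQ: "Suc i < length Q" "Suc (Suc i) < length Q" using p len by auto
    have "pivot i Q \<in> ?P"
      using pivot_in_ham_paths[OF assms(3) p(2,3) iQ(1) p(5)] .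
    moreover have "E (last (pivot i Q)) (pivot i Q ! i)"
      using iQ p(2) assms(3)
      by (auto simp: last_pivot nth_pivot ham_paths_def successively_conv_nth symp_def)
    moreover have "last (pivot i Q) \<noteq> last Q"
    proof -
      have "Q ! Suc i \<noteq> Q ! (length Q - 1)"
        using iQ p(2) by (subst nth_eq_iff_index_eq) (auto simp: ham_paths_def)
      then show ?thesis using iQ by (cases "Q = []") (simp_all add: last_pivot last_conv_nth)
    qed
    ultimately show "(\<lambda>(Q, i). (pivot i Q, i)) p \<in> Z
        \<and> (\<lambda>(Q, i). (pivot i Q, i)) ((\<lambda>(Q, i). (pivot i Q, i)) p) = p
        \<and> (\<lambda>(Q, i). (pivot i Q, i)) p \<noteq> p"
      using p iQ by (auto simp: Z_def J_def pivot_pivot)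
  qed
  moreover have "card Z = (\<Sum>Q\<in>?P. card (J Q))"
    unfolding Z_def using finP finJ by (simp add: card_SigmaI)
  moreover have "(\<Sum>Q\<in>?P. card (J Q)) + card {Q \<in> ?P. E (last Q) u} = 2 * card ?P"
  proof -
    have "card {Q \<in> ?P. E (last Q) u} = (\<Sum>Q\<in>?P. if E (last Q) u then 1 else 0)"
      using finP by (simp add: sum.inter_filter[symmetric])
    then have "(\<Sum>Q\<in>?P. card (J Q)) + card {Q \<in> ?P. E (last Q) u}
        = (\<Sum>Q\<in>?P. card (J Q) + (if E (last Q) u then 1 else 0))"
      by (simp only: sum.distrib)
    also have "\<dots> = (\<Sum>Q\<in>?P. 2)" by (rule sum.cong) (use cardJ in auto)
    finally show ?thesis by simp
  qed
  ultimately have "even (card Z + card {Q \<in> ?P. E (last Q) u})" "even (card Z)" by simp_all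
  then show ?thesis by (simp add: even_add)
qed

section \<open>Adjacency on a cyclic list\<close>

definition cedge :: "'v list \<Rightarrow> ('v \<times> 'v) set" where
  "cedge L = set (zip L (rotate1 L))"

definition cadj :: "'v list \<Rightarrow> 'v \<Rightarrow> 'v \<Rightarrow> bool" where
  "cadj L x y \<longleftrightarrow> (x, y) \<in> cedge L \<or> (y, x) \<in> cedge L"

lemma cadj_sym: "cadj L x y \<longleftrightarrow> cadj L y x"
  by (auto simp: cadj_def)

lemma cedge_nth: "(x, y) \<in> cedge L \<longleftrightarrow> (\<exists>i<length L. x = L ! i \<and> y = L ! (Suc i mod length L))"
  by (auto simp: cedge_def in_set_zip nth_rotate1)

lemma cedge_Cons: "cedge (x # xs) = set (zip (x # xs) (xs @ [x]))"
  by (simp add: cedge_def)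

lemma cadj_in_set: "cadj L x y \<Longrightarrow> x \<in> set L \<and> y \<in> set L"
  by (auto simp: cadj_def cedge_def dest: set_zip_leftD set_zip_rightD)

lemma cedge_rotate1: "cedge (rotate1 L) = cedge L"
proof -
  have "zip (rotate1 L) (rotate1 (rotate1 L)) = rotate1 (zip L (rotate1 L))"
  proof (rule nth_equalityI)
    fix i assume "i < length (zip (rotate1 L) (rotate1 (rotate1 L)))"
    then have "i < length L" "Suc i mod length L < length L"
      by (auto intro: mod_less_divisor)
    then show "zip (rotate1 L) (rotate1 (rotate1 L)) ! i = rotate1 (zip L (rotate1 L)) ! i"
      by (simp add: nth_rotate1)
  qed simp
  then show ?thesis by (simp add: cedge_def)
qed

lemma cadj_rotate: "cadj (rotate k L) = cadj L"
proof -
  have "cedge (rotate k L) = cedge L"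
    by (induction k) (simp_all add: cedge_rotate1)
  then show ?thesis by (simp add: cadj_def fun_eq_iff)
qed

lemma cadj_Cons_rev: "cadj (x # rev xs) = cadj (x # xs)"
proof -
  have "set (zip (x # rev xs) (rev xs @ [x])) = (set (zip (rev xs @ [x]) (x # rev xs)))\<inverse>"
    by (auto simp: in_set_zip)
  also have "zip (rev xs @ [x]) (x # rev xs) = rev (zip (x # xs) (xs @ [x]))"
    by (subst zip_rev[symmetric]) simp_all
  finally have "cedge (x # rev xs) = (cedge (x # xs))\<inverse>"
    by (simp only: cedge_Cons set_rev)
  then show ?thesis by (auto simp: cadj_def fun_eq_iff)
qed

lemma cedge_iff_successively:
  assumes "Q \<noteq> []"
  shows "(\<forall>x y. (x, y) \<in> cedge Q \<longrightarrow> E x y) \<longleftrightarrow> successively E Q \<and> E (last Q) (hd Q)"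
proof -
  obtain a q where Q: "Q = a # q" using assms by (cases Q) auto
  have "(\<forall>(x, y)\<in>set (zip (b # q) (q @ [c])). E x y) \<longleftrightarrow> successively E (b # q) \<and> E (last (b # q)) c" for b c q
    by (induction q arbitrary: b) auto
  from this[of a q a] show ?thesis unfolding Q cedge_Cons list.sel by blast
qed

lemma cadj_Cons_nbrs:
  assumes "distinct (x # xs)" "2 \<le> length xs"
  shows "{y. cadj (x # xs) x y} = {hd xs, last xs}"
proof -
  have zip: "set (zip (b # q) (q @ [c])) = {(b, hd (q @ [c]))} \<union> set (zip q (tl q @ [c]))" for b c :: 'a and q
    by (cases q) auto
  have l: "(y, c) \<in> set (zip (b # q) (q @ [c])) \<longleftrightarrow> y = last (b # q)" if "c \<notin> set q" for b c y :: 'a and q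
    using that by (induction q arbitrary: b) auto
  have f: "(b, y) \<in> set (zip (b # q) (q @ [c])) \<longleftrightarrow> y = hd (q @ [c])" if "b \<notin> set q" for b c y :: 'a and q
    using that by (cases q) (auto dest: set_zip_leftD)
  have "xs \<noteq> []" using assms(2) by auto
  then show ?thesis
    using assms(1) l[of x xs _ x] f[of x xs _ x] by (auto simp: cadj_def cedge_Cons)
qed

lemma rotate_to_front:
  assumes "x \<in> set L"
  obtains k xs where "rotate k L = x # xs"
proof -
  from assms obtain ys zs where L: "L = ys @ x # zs" by (meson split_list)
  then have "rotate (length ys) L = x # (zs @ ys)" by (simp add: rotate_append)
  then show thesis by (rule that)
qed

lemma card_cadj_nbrs:
  assumes "distinct L" "3 \<le> length L" "x \<in> set L"
  shows "card {y. cadj L x y} = 2"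
proof -
  obtain k xs where r: "rotate k L = x # xs" using rotate_to_front[OF assms(3)] .
  have d: "distinct (x # xs)" using assms(1) distinct_rotate[of k L] by (simp add: r)
  have l: "2 \<le> length xs" using arg_cong[OF r, of length] assms(2) by simp
  then obtain a b ys where xs: "xs = a # b # ys"
    by (metis One_nat_def Suc_1 Suc_le_length_iff)
  have "hd xs \<noteq> last xs" using d by (auto simp: xs)
  then show ?thesis
    using cadj_Cons_nbrs[OF d l] cadj_rotate[of k L] by (simp add: r)
qed

text \<open>Each edge meets \<open>A\<close> at most once. Every vertex of \<open>A\<close> accounts
  for two of the \<open>length Q - 1\<close> edges, except that the first one has no edge before it
  and a last one has none after it.\<close>

lemma card_avoiding_positions:
  assumes "distinct Q" "A \<subseteq> set Q" "hd Q \<in> A"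
    and "\<And>p. Suc p < length Q \<Longrightarrow> \<not> (Q ! p \<in> A \<and> Q ! Suc p \<in> A)"
  shows "card {p. Suc p < length Q \<and> Q ! p \<notin> A \<and> Q ! Suc p \<notin> A} + 2 * card A
    = length Q + (if last Q \<in> A then 1 else 0)"
proof -
  define n where "n = length Q"
  have n: "0 < n" using assms(2,3) by (cases Q) (auto simp: n_def)
  define I where "I = {p. p < n \<and> Q ! p \<in> A}"
  have "A = (!) Q ` I" using assms(2) by (fastforce simp: I_def n_def in_set_conv_nth)
  moreover have "inj_on ((!) Q) I"
    using assms(1) by (auto simp: I_def n_def inj_on_def nth_eq_iff_index_eq)
  ultimately have cA: "card A = card I" by (simp add: card_image)
  have finI: "finite I" by (simp add: I_def)
  have I0: "0 \<in> I" using assms(3) n by (auto simp: I_def n_def hd_conv_nth)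
  have Il: "n - 1 \<in> I \<longleftrightarrow> last Q \<in> A"
    using n by (auto simp: I_def n_def last_conv_nth)
  let ?J = "{p. Suc p < n \<and> Q ! p \<notin> A \<and> Q ! Suc p \<notin> A}"
  let ?I1 = "I - {n - 1}" and ?I2 = "{p. Suc p \<in> I}"
  have "{..<n - 1} = ?J \<union> (?I1 \<union> ?I2)"
    by (auto simp: I_def)
  moreover have "?J \<inter> (?I1 \<union> ?I2) = {}" by (auto simp: I_def)
  moreover have "?I1 \<inter> ?I2 = {}"
    using assms(4) by (auto simp: I_def n_def)
  moreover have fin: "finite ?J" "finite ?I1" "finite ?I2"
    using finI by (auto intro: finite_subset[of _ "{..<n}"] simp: I_def)
  ultimately have c1: "n - 1 = card ?J + (card ?I1 + card ?I2)"
    by (metis (no_types, lifting) card_Un_disjoint card_lessThan finite_UnI)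
  have c2: "card ?I2 = card I - 1"
  proof -
    have "Suc ` ?I2 = I - {0}" using I0 by (auto simp: image_iff elim: not0_implies_Suc[THEN exE])
    then have "card ?I2 = card (I - {0})" by (metis card_image inj_Suc inj_on_subset subset_UNIV)
    then show ?thesis using I0 finI by simp
  qed
  have c3: "card ?I1 = card I - (if last Q \<in> A then 1 else 0)"
    using Il finI by auto
  have c4: "card I \<ge> 1" using I0 finI card_gt_0_iff[of I] by force
  have "card ?J + 2 * card A = n + (if last Q \<in> A then 1 else 0)"
  proof (cases "last Q \<in> A")
    case True
    show ?thesis unfolding cA using n c1 c2 c3 c4 True by simp
  next
    case False
    show ?thesis unfolding cA using n c1 c2 c3 c4 False by simp
  qed
  then show ?thesis by (simp only: n_def)
qed

section \<open>Hamiltonian cycles of a cycle with stars\<close>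

text \<open>
  The vertex \<open>z\<close> subdivides an edge that every cycle considered has to keep.  It has no star edge,
  so it must never be the end of a Hamiltonian path; this is why it has to be the second vertex of
  the list when it is adjacent to \<open>A\<close>.
\<close>

locale star_cycle =
  fixes L :: "'v list" and A T :: "'v set" and s :: "'v \<Rightarrow> 'v" and z :: 'v
  assumes dist: "distinct L" and len: "3 \<le> length L"
    and A_sub: "A \<subseteq> set L" and T_sub: "T \<subseteq> set L" and AT: "A \<inter> T = {}"
    and sA: "i \<in> T \<Longrightarrow> s i \<in> A"
    and indepA: "a \<in> A \<Longrightarrow> b \<in> A \<Longrightarrow> \<not> cadj L a b"
    and far: "i \<in> T \<Longrightarrow> \<not> cadj L i (s i)"
    and z: "z \<in> set L" "z \<notin> A" "z \<notin> T"
    and start: "hd L \<in> A"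
    and nbr: "a \<in> A \<Longrightarrow> cadj L a i \<Longrightarrow> i = z \<or> i \<in> T"
    and second: "a \<in> A \<Longrightarrow> cadj L a z \<Longrightarrow> L ! 1 = z"
begin

definition star :: "'v \<Rightarrow> 'v \<Rightarrow> bool" where
  "star x y \<longleftrightarrow> x \<in> T \<and> y = s x \<or> y \<in> T \<and> x = s y"

definition E :: "'v \<Rightarrow> 'v \<Rightarrow> bool" where
  "E x y \<longleftrightarrow> cadj L x y \<or> star x y"

lemma E_sym: "E x y \<longleftrightarrow> E y x"
  using cadj_sym[of L x y] by (auto simp: E_def star_def)

lemma L_nonempty: "L \<noteq> []"
  using len by auto

lemma cadj_irrefl: "\<not> cadj L x x"
proof
  assume *: "cadj L x x"
  then have "x \<in> set L" by (auto dest: cadj_in_set)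
  then obtain k xs where r: "rotate k L = x # xs" using rotate_to_front by metis
  have d: "distinct (x # xs)" using dist distinct_rotate[of k L] by (simp add: r)
  have l: "2 \<le> length xs" using arg_cong[OF r, of length] len by simp
  have "x \<in> {hd xs, last xs}"
    using cadj_Cons_nbrs[OF d l] cadj_rotate[of k L] * by (auto simp: r)
  moreover have "xs \<noteq> []" using l by auto
  ultimately show False using d by auto
qed

lemma E_irrefl: "\<not> E x x"
  using cadj_irrefl AT sA unfolding E_def star_def by (metis disjoint_iff)

lemma E_not_both_A: "E x y \<Longrightarrow> \<not> (x \<in> A \<and> y \<in> A)"
  using indepA AT by (auto simp: E_def star_def)

text \<open>Unordered pairs, since another Hamiltonian path may traverse the same edge in the
  opposite direction.\<close>

definition avoiding_edges :: "'v list \<Rightarrow> 'v set set" where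
  "avoiding_edges Q = (\<lambda>p. {Q ! p, Q ! Suc p}) ` {p. Suc p < length Q \<and> Q ! p \<notin> A \<and> Q ! Suc p \<notin> A}"

text \<open>The closing edge is not a step of the list, but it has the end \<open>hd L\<close> in
  \<open>A\<close>, so nothing is missed.\<close>

lemma avoiding_edges_L: "{x, y} \<in> avoiding_edges L" if "cadj L x y" "x \<notin> A" "y \<notin> A"
proof -
  have *: "{x, y} \<in> avoiding_edges L" if xy: "(x, y) \<in> cedge L" "x \<notin> A" "y \<notin> A" for x y
  proof -
    obtain i where i: "i < length L" "x = L ! i" "y = L ! (Suc i mod length L)"
      using xy(1) by (auto simp: cedge_nth)
    have "Suc i \<noteq> length L" using start xy(3) i L_nonempty by (auto simp: hd_conv_nth)
    then show ?thesis using i xy by (auto simp: avoiding_edges_def)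
  qed
  show ?thesis
    using that *[of x y] *[of y x] by (auto simp: cadj_def insert_commute)
qed

text \<open>Star edges have only one end in \<open>A\<close>, so \<open>A\<close> stays independent
  in \<open>E\<close>. The count therefore depends on the path only through its last vertex.\<close>

lemma card_avoiding_edges:
  assumes "distinct Q" "set Q = set L" "hd Q \<in> A" "successively E Q"
  shows "card (avoiding_edges Q) + 2 * card A = length L + (if last Q \<in> A then 1 else 0)"
proof -
  have "inj_on (\<lambda>p. {Q ! p, Q ! Suc p}) {p. Suc p < length Q \<and> Q ! p \<notin> A \<and> Q ! Suc p \<notin> A}"
    using assms(1) by (auto simp: inj_on_def doubleton_eq_iff nth_eq_iff_index_eq)
  then have "card (avoiding_edges Q) = card {p. Suc p < length Q \<and> Q ! p \<notin> A \<and> Q ! Suc p \<notin> A}"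
    unfolding avoiding_edges_def by (rule card_image)
  moreover have "length Q = length L"
    using assms(1,2) dist distinct_card[of Q] distinct_card[of L] by simp
  moreover have "\<not> (Q ! p \<in> A \<and> Q ! Suc p \<in> A)" if "Suc p < length Q" for p
    using E_not_both_A successively_nth[OF assms(4) that] by blast
  ultimately show ?thesis
    using card_avoiding_positions[of Q A] assms(1-3) A_sub by simp
qed

lemma L_ham: "L \<in> ham_paths E (set L) (hd L) (L ! 1)" "E (last L) (hd L)" "last L \<notin> A"
proof -
  have "successively (cadj L) L \<and> cadj L (last L) (hd L)"
    using cedge_iff_successively[OF L_nonempty, of "cadj L"] by (auto simp: cadj_def)
  then have *: "successively (cadj L) L" "cadj L (last L) (hd L)" by auto
  then have "successively E L"
    by (auto simp: E_def intro: successively_mono)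
  then show "L \<in> ham_paths E (set L) (hd L) (L ! 1)"
    using dist L_nonempty by (simp add: ham_paths_def hd_conv_nth)
  show "E (last L) (hd L)" "last L \<notin> A"
    using * indepA start by (auto simp: E_def)
qed

text \<open>
  As the edges avoiding \<open>A\<close> all lie on \<open>L\<close>, counting them shows that a Hamiltonian path from \<open>A\<close>
  cannot end in \<open>A\<close> and contains all of them.  This is what makes the end vertex have odd degree.
\<close>

lemma ham_path_props:
  assumes "Q \<in> ham_paths E (set L) (hd L) (L ! 1)"
  shows "last Q \<notin> A" "avoiding_edges Q = avoiding_edges L" "length Q = length L" "hd Q = hd L"
    "distinct Q" "set Q = set L" "successively E Q" "Q ! 1 = L ! 1"
proof -
  show Q: "distinct Q" "set Q = set L" "successively E Q" "Q ! 1 = L ! 1"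
    using assms by (auto simp: ham_paths_def)
  show lQ: "length Q = length L" using Q dist distinct_card[of Q] distinct_card[of L] by simp
  then have "Q \<noteq> []" using L_nonempty by auto
  then show hQ: "hd Q = hd L" using assms by (auto simp: ham_paths_def hd_conv_nth)
  have sub: "avoiding_edges Q \<subseteq> avoiding_edges L"
  proof
    fix e assume "e \<in> avoiding_edges Q"
    then obtain p where p: "e = {Q ! p, Q ! Suc p}" "Suc p < length Q" "Q ! p \<notin> A" "Q ! Suc p \<notin> A"
      by (auto simp: avoiding_edges_def)
    have "E (Q ! p) (Q ! Suc p)" using Q(3) p(2) by (rule successively_nth)
    then have "cadj L (Q ! p) (Q ! Suc p)" using p sA by (auto simp: E_def star_def)
    then show "e \<in> avoiding_edges L" using avoiding_edges_L p by auto
  qed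
  have fin: "finite (avoiding_edges L)"
    unfolding avoiding_edges_def by (rule finite_imageI, rule finite_subset[of _ "{..<length L}"]) auto
  have cL: "card (avoiding_edges L) + 2 * card A = length L"
  proof -
    have "successively E L" using L_ham(1) by (simp add: ham_paths_def)
    then show ?thesis using card_avoiding_edges[OF dist refl start] L_ham(3) by simp
  qed
  have cQ: "card (avoiding_edges Q) + 2 * card A = length L + (if last Q \<in> A then 1 else 0)"
    by (rule card_avoiding_edges) (use Q hQ start in auto)
  then show "last Q \<notin> A" using cL card_mono[OF fin sub] by (auto split: if_splits)
  then show "avoiding_edges Q = avoiding_edges L"
    using card_subset_eq[OF fin sub] cL cQ by simp
qed

text \<open>If the end had no cycle neighbour in \<open>A\<close>, both its cycle edges would avoid
  \<open>A\<close> and lie on \<open>Q\<close>, where an end has only one edge. So it is next to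
  \<open>A\<close>; it is not \<open>z\<close>, which would then be second in the list, and hence it
  lies in \<open>T\<close> and has one star edge besides its two cycle edges.\<close>

lemma card_last_nbrs:
  assumes "Q \<in> ham_paths E (set L) (hd L) (L ! 1)"
  shows "card {x \<in> set L. E (last Q) x} = 3"
proof -
  note Q = ham_path_props[OF assms]
  define w where "w = last Q"
  have Qne: "Q \<noteq> []" using Q(3) L_nonempty by auto
  have w: "w \<in> set L" "w \<notin> A" "w = Q ! (length Q - 1)"
    using Q(1,6) last_in_set[OF Qne] by (simp_all add: w_def last_conv_nth Qne)
  have card2: "card {y. cadj L w y} = 2" using card_cadj_nbrs dist len w(1) .
  have "\<exists>a\<in>A. cadj L w a"
  proof (rule ccontr)
    assume none: "\<not> (\<exists>a\<in>A. cadj L w a)"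
    have "y = Q ! (length Q - 2)" if y: "cadj L w y" for y
    proof -
      have "{w, y} \<in> avoiding_edges Q"
        using avoiding_edges_L[OF y w(2)] none y Q(2) by auto
      then obtain p where p: "{w, y} = {Q ! p, Q ! Suc p}" "Suc p < length Q"
        by (auto simp: avoiding_edges_def)
      have "w \<noteq> Q ! p" using p(2) Q(5) w(3) by (auto simp: nth_eq_iff_index_eq)
      then have "w = Q ! Suc p" "y = Q ! p" using p(1) by (auto simp: doubleton_eq_iff)
      then have "length Q - 1 = Suc p"
        using w(3) p(2) Q(5) by (metis Qne diff_less length_greater_0_conv nth_eq_iff_index_eq zero_less_one)
      then have "p = length Q - 2" by simp
      then show ?thesis using \<open>y = Q ! p\<close> by simp
    qed
    then have "{y. cadj L w y} \<subseteq> {Q ! (length Q - 2)}" by blast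
    then have "card {y. cadj L w y} \<le> card {Q ! (length Q - 2)}" by (rule card_mono[rotated]) simp
    then show False using card2 by simp
  qed
  then obtain a where a: "a \<in> A" "cadj L a w" using cadj_sym[of L w] by blast
  have "w \<noteq> z"
  proof
    assume "w = z"
    then have "Q ! 1 = Q ! (length Q - 1)" using second[OF a(1)] a(2) Q(8) w(3) by simp
    then show False using Q(3,5) len by (simp add: nth_eq_iff_index_eq)
  qed
  then have wT: "w \<in> T" using nbr[OF a] by simp
  have "{x \<in> set L. E w x} = insert (s w) {y. cadj L w y}"
    using wT w(2) sA A_sub by (auto simp: E_def star_def dest: cadj_in_set)
  moreover have "s w \<notin> {y. cadj L w y}" using far[OF wT] by simp
  moreover have "finite {y. cadj L w y}" using card2 card.infinite by fastforce
  ultimately show ?thesis using card2 by (simp add: w_def)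
qed

text \<open>\<open>L\<close> itself is one of an even number of closing paths.\<close>

lemma second_ham_cycle:
  obtains Q where "Q \<in> ham_paths E (set L) (hd L) (L ! 1)" "E (last Q) (hd L)" "Q \<noteq> L"
proof -
  define C where "C = {Q \<in> ham_paths E (set L) (hd L) (L ! 1). E (last Q) (hd L)}"
  have "even (card C)"
    unfolding C_def
  proof (rule even_closing_ham_paths)
    show "3 \<le> card (set L)" using len dist by (simp add: distinct_card)
    show "symp E" using E_sym by (auto simp: symp_def)
  qed (use E_irrefl card_last_nbrs in auto)
  then have "C \<noteq> {L}" by auto
  moreover have "L \<in> C" using L_ham by (simp add: C_def)
  ultimately obtain Q where "Q \<in> C" "Q \<noteq> L" by blast
  then show thesis by (intro that[of Q]) (simp_all add: C_def)
qed

text \<open>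
  If every vertex of \<open>A\<close> were incident with 0 or 2 new edges, those with 2 would contradict
  minimality: each of their neighbours on the cycle loses an edge, and so uses its star edge.
\<close>

lemma vertex_with_single_star_edge:
  assumes Q: "Q \<in> ham_paths E (set L) (hd L) (L ! 1)" "E (last Q) (hd L)" "Q \<noteq> L"
    and minimal: "\<And>B. B \<subset> A \<Longrightarrow> B \<noteq> {} \<Longrightarrow> \<exists>b\<in>B. \<exists>i. cadj L b i \<and> i \<noteq> z \<and> \<not> (i \<in> T \<and> s i \<in> B)"
  shows "\<exists>a\<in>A. card {y. cadj Q a y \<and> \<not> cadj L a y} = 1"
proof (rule ccontr)
  assume none: "\<not> ?thesis"
  note props = ham_path_props[OF Q(1)]
  have Qne: "Q \<noteq> []" using props(3) L_nonempty by auto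
  have D_E: "E x y" if "cadj Q x y" for x y
    using that cedge_iff_successively[OF Qne, of E] props(4,7) Q(2) E_sym
    by (auto simp: cadj_def)
  have deg: "card {y. cadj Q x y} = 2" "finite {y. cadj Q x y}" if "x \<in> set L" for x
  proof -
    show "card {y. cadj Q x y} = 2"
      by (rule card_cadj_nbrs) (use props that len in auto)
    then show "finite {y. cadj Q x y}" by (intro card_ge_0_finite) simp
  qed
  have degL: "card {y. cadj L x y} = 2" "finite {y. cadj L x y}" if "x \<in> set L" for x
  proof -
    show "card {y. cadj L x y} = 2" by (rule card_cadj_nbrs[OF dist len that])
    then show "finite {y. cadj L x y}" by (intro card_ge_0_finite) simp
  qed
  have D_avoid: "cadj Q x y" if xy: "cadj L x y" "x \<notin> A" "y \<notin> A" for x y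
  proof -
    obtain p where p: "{x, y} = {Q ! p, Q ! Suc p}" "Suc p < length Q"
      using avoiding_edges_L[OF xy] unfolding props(2)[symmetric] by (auto simp: avoiding_edges_def)
    have "(Q ! p, Q ! Suc p) \<in> cedge Q"
      unfolding cedge_nth using p(2) by (intro exI[of _ p]) simp
    then show ?thesis using p(1) by (auto simp: cadj_def doubleton_eq_iff)
  qed
  have D_start: "cadj Q (hd L) (L ! 1)"
  proof -
    have "(Q ! 0, Q ! 1) \<in> cedge Q"
      unfolding cedge_nth using props(3) len L_nonempty by (intro exI[of _ 0]) simp
    then show ?thesis using props(4,8) Qne by (simp add: cadj_def hd_conv_nth)
  qed
  have L_step: "cadj L (L ! p) (L ! Suc p)" if "Suc p < length L" for p
    unfolding cadj_def cedge_nth using that by (intro disjI1 exI[of _ p]) simp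
  \<comment> \<open>Using edges of \<open>L\<close> only, \<open>Q\<close> would run around the same
    cycle, and its first two vertices fix the direction, so the lists would agree.\<close>
  have new: "\<exists>x y. cadj Q x y \<and> \<not> cadj L x y"
  proof (rule ccontr)
    assume "\<not> ?thesis"
    then have sub: "cadj L x y" if "cadj Q x y" for x y using that by blast
    have "Q ! p = L ! p" if "p < length L" for p
      using that
    proof (induction p rule: less_induct)
      case (less p)
      consider "p = 0" | "p = 1" | q where "p = Suc (Suc q)" by (metis One_nat_def not0_implies_Suc)
      then show ?case
      proof cases
        case 1 then show ?thesis using props(4) Qne L_nonempty by (simp add: hd_conv_nth)
      next
        case 2 then show ?thesis using props(8) by simp
      next
        case (3 q)
        have IH: "Q ! q = L ! q" "Q ! Suc q = L ! Suc q" using less 3 by simp_all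
        have "(Q ! Suc q, Q ! p) \<in> cedge Q"
          unfolding cedge_nth using less.prems props(3) 3 by (intro exI[of _ "Suc q"]) simp
        then have "cadj L (L ! Suc q) (Q ! p)"
          using sub IH by (auto simp: cadj_def)
        moreover have "cadj L (L ! Suc q) (L ! q)" "cadj L (L ! Suc q) (L ! p)"
          using L_step[of q] L_step[of "Suc q"] less.prems 3 cadj_sym[of L "L ! q"] by auto
        moreover have "L ! q \<noteq> L ! p"
          using less.prems 3 dist by (simp add: nth_eq_iff_index_eq)
        moreover have "L ! q \<noteq> Q ! p"
          unfolding IH(1)[symmetric] using less.prems 3 props(3,5) by (simp add: nth_eq_iff_index_eq)
        ultimately have "card {L ! q, L ! p, Q ! p} \<le> 2"
          using degL[of "L ! Suc q"] less.prems 3 card_mono[of "{y. cadj L (L ! Suc q) y}" "{L ! q, L ! p, Q ! p}"]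
          by simp
        then show ?thesis using \<open>L ! q \<noteq> L ! p\<close> \<open>L ! q \<noteq> Q ! p\<close> by (cases "Q ! p = L ! p") simp_all
      qed
    qed
    then have "Q = L" using props(3) by (simp add: list_eq_iff_nth_eq)
    then show False using Q(3) by simp
  qed
  \<comment> \<open>The vertices of \<open>A\<close> with two new edges; by \<open>none\<close>, all
    others in \<open>A\<close> keep both edges of \<open>L\<close>.\<close>
  define B where "B = {a \<in> A. \<forall>y. cadj Q a y \<longrightarrow> \<not> cadj L a y}"
  have old: "\<not> cadj Q a y \<or> cadj L a y" if a: "a \<in> A" "a \<notin> B" for a y
  proof -
    let ?N = "{y. cadj Q a y}" and ?S = "{y. cadj Q a y \<and> \<not> cadj L a y}"
    have "a \<in> set L" using a A_sub by blast
    note d = deg[OF this]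
    obtain y' where "cadj Q a y'" "cadj L a y'" using a by (auto simp: B_def)
    then have "?S \<subset> ?N" by blast
    then have "card ?S < 2" using psubset_card_mono[OF d(2)] d(1) by simp
    moreover have "card ?S \<noteq> 1" using none a by blast
    ultimately have "card ?S = 0" by linarith
    moreover have "finite ?S" using d(2) by (rule rev_finite_subset) blast
    ultimately show ?thesis by auto
  qed
  \<comment> \<open>The prescribed first edge keeps \<open>hd L\<close> out of \<open>B\<close>, so
    \<open>B\<close> is a proper subset and \<open>minimal\<close> applies to it.\<close>
  have "cadj L (hd L) (L ! 1)"
    using L_step[of 0] len L_nonempty by (simp add: hd_conv_nth)
  then have "hd L \<notin> B" using D_start by (auto simp: B_def)
  then have "B \<subset> A" using start by (auto simp: B_def)
  moreover have "B \<noteq> {}"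
  proof -
    obtain x y where xy: "cadj Q x y" "\<not> cadj L x y" using new by blast
    then have "star x y" using D_E E_def by blast
    then have "x \<in> A \<or> y \<in> A" using sA by (auto simp: star_def)
    then show ?thesis using xy old[of x y] old[of y x] cadj_sym[of Q x y] cadj_sym[of L x y] by blast
  qed
  ultimately obtain b i where b: "b \<in> B" "cadj L b i" "i \<noteq> z" "\<not> (i \<in> T \<and> s i \<in> B)"
    using minimal by blast
  have bA: "b \<in> A" using b(1) by (simp add: B_def)
  have iT: "i \<in> T" using nbr[OF bA b(2)] b(3) by blast
  then have iL: "i \<in> set L" "i \<notin> A" using T_sub AT by auto
  have nb: "\<not> cadj Q i b" "cadj L i b"
    using b(1,2) cadj_sym[of Q i b] cadj_sym[of L i b] by (auto simp: B_def)
  \<comment> \<open>Having lost the edge to \<open>b\<close>, the vertex \<open>i\<close> must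
    regain degree two in \<open>Q\<close> by a new edge, which can only be its star edge.\<close>
  have "\<exists>y. cadj Q i y \<and> \<not> cadj L i y"
  proof (rule ccontr)
    assume "\<not> ?thesis"
    then have "{y. cadj Q i y} \<subset> {y. cadj L i y}" using nb by blast
    then show False
      using psubset_card_mono[OF degL(2)[OF iL(1)], of "{y. cadj Q i y}"] deg(1)[OF iL(1)] degL(1)[OF iL(1)]
      by linarith
  qed
  then obtain y where y: "cadj Q i y" "\<not> cadj L i y" by blast
  then have "star i y" using D_E E_def by blast
  then have "y = s i" using iL(2) sA by (auto simp: star_def)
  moreover have "s i \<in> A" using sA iT by blast
  ultimately have "s i \<in> B"
    using y old[of y i] cadj_sym[of Q i y] cadj_sym[of L i y] by blast
  then show False using b(4) iT by blast
qed

end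

section \<open>Rerouting a path with stars while keeping its ends\<close>

definition consec :: "nat \<Rightarrow> nat \<Rightarrow> bool" where
  "consec i j \<longleftrightarrow> j = Suc i \<or> i = Suc j"

lemma consec_sym: "consec i j \<longleftrightarrow> consec j i"
  by (auto simp: consec_def)

lemma cedge_upt: "(x, y) \<in> cedge [0..<Suc m] \<longleftrightarrow> x \<le> m \<and> y = Suc x mod Suc m"
proof -
  have "[0..<Suc m] ! (Suc x mod Suc m) = Suc x mod Suc m" for x
    using nth_upt[of 0 "Suc x mod Suc m" "Suc m"] by simp
  then show ?thesis
    unfolding cedge_nth by (auto simp del: upt_Suc simp: less_Suc_eq_le)
qed

lemma cadj_upt:
  assumes "2 \<le> m"
  shows "cadj [0..<Suc m] x y \<longleftrightarrow> x \<le> m \<and> y \<le> m \<and> (consec x y \<or> {x, y} = {0, m})"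
proof -
  have "(x, y) \<in> cedge [0..<Suc m] \<longleftrightarrow> x \<le> m \<and> y \<le> m \<and> (y = Suc x \<or> x = m \<and> y = 0)" for x y
    using assms by (cases "x = m") (auto simp: cedge_upt simp del: upt_Suc)
  then show ?thesis
    by (auto simp: cadj_def consec_def doubleton_eq_iff)
qed

lemma cadj_Cons_nth:
  assumes "distinct (c # D)" "p < length D" "q < length D"
  shows "cadj (c # D) (D ! p) (D ! q) \<longleftrightarrow> consec p q"
proof -
  have *: "(D ! p, D ! q) \<in> cedge (c # D) \<longleftrightarrow> q = Suc p" if "p < length D" "q < length D" for p q
  proof
    assume "(D ! p, D ! q) \<in> cedge (c # D)"
    then obtain i where i: "i < length (c # D)" "D ! p = (c # D) ! i"
      "D ! q = (c # D) ! (Suc i mod length (c # D))"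
      by (auto simp: cedge_nth)
    have "D ! p \<noteq> c" "D ! q \<noteq> c" using assms(1) that by auto
    then obtain j where j: "i = Suc j" using i by (cases i) auto
    then have "j = p" using i assms(1) that by (simp add: nth_eq_iff_index_eq)
    moreover have "Suc i < length (c # D)" using i \<open>D ! q \<noteq> c\<close> by (cases "Suc i = length (c # D)") auto
    ultimately show "q = Suc p" using i assms(1) that j by (simp add: nth_eq_iff_index_eq)
  next
    assume "q = Suc p"
    then show "(D ! p, D ! q) \<in> cedge (c # D)"
      unfolding cedge_nth using that by (intro exI[of _ "Suc p"]) simp
  qed
  show ?thesis
    using *[OF assms(2,3)] *[OF assms(3,2)] by (auto simp: cadj_def consec_def)
qed

text \<open>Provides the list required by \<open>star_cycle\<close>: the path on the numbers below
  \<open>m\<close> is closed through the extra vertex \<open>m\<close>. If an end of the path is in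
  \<open>B\<close>, the list starts there and continues with \<open>m\<close>: backwards from 0,
  forwards from \<open>m - 1\<close>.\<close>

lemma cycle_list_from:
  assumes "2 \<le> m" "a < m" "a \<in> B"
    and "0 \<in> B \<or> m - 1 \<in> B \<Longrightarrow> a = (if 0 \<in> B then 0 else m - 1)"
  obtains L where "distinct L" "set L = {..m}" "length L = Suc m" "cadj L = cadj [0..<Suc m]"
    "hd L = a" "0 \<in> B \<or> m - 1 \<in> B \<Longrightarrow> L ! 1 = m"
proof (cases "0 \<in> B")
  case True
  have e: "[0..<Suc m] = 0 # [1..<Suc m]" by (subst upt_conv_Cons) auto
  show thesis
  proof (rule that[of "0 # rev [1..<Suc m]"])
    show "cadj (0 # rev [1..<Suc m]) = cadj [0..<Suc m]" by (simp only: e cadj_Cons_rev)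
    show "(0 # rev [1..<Suc m]) ! 1 = m" using assms(1) by (simp add: rev_nth)
    show "set (0 # rev [1..<Suc m]) = {..m}" by auto
    show "hd (0 # rev [1..<Suc m]) = a" using assms(4) True by simp
  qed simp_all
next
  case False
  have e: "[0..<Suc m] = [0..<a] @ [a..<Suc m]"
    using upt_add_eq_append[of 0 a "Suc m - a"] assms(2) by simp
  have r: "rotate a [0..<Suc m] = [a..<Suc m] @ [0..<a]"
    using rotate_append[of "[0..<a]" "[a..<Suc m]"] by (simp only: e length_upt) simp
  show thesis
  proof (rule that[of "rotate a [0..<Suc m]"])
    show "cadj (rotate a [0..<Suc m]) = cadj [0..<Suc m]" by (rule cadj_rotate)
    show "hd (rotate a [0..<Suc m]) = a" using assms(2) by (simp add: r hd_append hd_upt del: upt_Suc)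
    show "rotate a [0..<Suc m] ! 1 = m" if "0 \<in> B \<or> m - 1 \<in> B"
    proof -
      have "Suc a = m" using that assms(1,4) False by auto
      then have "[a..<Suc m] = [a, m]" by (auto simp: upt_conv_Cons simp del: upt_Suc)
      then show ?thesis unfolding r by simp
    qed
  qed auto
qed

text \<open>The extra vertex \<open>m\<close> of the closed cycle has no star edge, so each
  Hamiltonian cycle keeps both its edges; deleting \<open>m\<close> leaves a path with the original
  ends. The last conclusion singles out a vertex of \<open>A\<close> with exactly one new
  edge.\<close>

lemma reroute_star_path:
  fixes A T :: "nat set" and s :: "nat \<Rightarrow> nat"
  assumes m: "2 \<le> m" and A: "A \<subseteq> {..<m}" "A \<noteq> {}" and indepA: "\<And>a. a \<in> A \<Longrightarrow> Suc a \<notin> A"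
    and T: "T \<subseteq> {..<m}" "A \<inter> T = {}"
    and s: "\<And>i. i \<in> T \<Longrightarrow> s i \<in> A \<and> \<not> consec i (s i)"
    and nbr: "\<And>a i. a \<in> A \<Longrightarrow> i < m \<Longrightarrow> consec a i \<Longrightarrow> i \<in> T"
  obtains D where "distinct D" "set D = {..<m}" "hd D = 0" "last D = m - 1"
    "\<forall>p. Suc p < m \<longrightarrow> consec (D ! p) (D ! Suc p)
       \<or> D ! p \<in> T \<and> s (D ! p) = D ! Suc p \<or> D ! Suc p \<in> T \<and> s (D ! Suc p) = D ! p"
    "\<exists>p<m. D ! p \<in> A \<and> (0 < p \<and> \<not> consec (D ! (p - 1)) (D ! p)) \<noteq> (Suc p < m \<and> \<not> consec (D ! p) (D ! Suc p))"
proof -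
  \<comment> \<open>Closed sets are those that can replace \<open>A\<close> as set of centres: all
    path neighbours have their star edge into the set. A minimal one meets the hypothesis of
    \<open>vertex_with_single_star_edge\<close>.\<close>
  define closed where "closed B \<longleftrightarrow> B \<subseteq> A \<and> B \<noteq> {} \<and> (\<forall>b\<in>B. \<forall>i<m. consec b i \<longrightarrow> i \<in> T \<and> s i \<in> B)" for B
  have finA: "finite A" using A finite_subset by blast
  have "closed A" using A(2) s nbr by (auto simp: closed_def)
  moreover have "finite {B. closed B}"
    by (rule finite_subset[of _ "Pow A"]) (auto simp: closed_def finA)
  ultimately obtain B where B: "closed B" "\<And>C. closed C \<Longrightarrow> C \<subseteq> B \<Longrightarrow> C = B"
    using finite_has_minimal[of "{B. closed B}"] by blast
  have BA: "B \<subseteq> A" "B \<noteq> {}" using B(1) by (auto simp: closed_def)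
  have Bm: "b < m" if "b \<in> B" for b using that BA A by blast
  define T' where "T' = {i \<in> T. s i \<in> B}"
  have T'm: "i < m" if "i \<in> T'" for i using that T by (auto simp: T'_def)
  obtain a where a: "a \<in> B" "0 \<in> B \<or> m - 1 \<in> B \<Longrightarrow> a = (if 0 \<in> B then 0 else m - 1)"
    using BA(2) by (metis all_not_in_conv)
  obtain L where L: "distinct L" "set L = {..m}" "length L = Suc m" "cadj L = cadj [0..<Suc m]"
    "hd L = a" "0 \<in> B \<or> m - 1 \<in> B \<Longrightarrow> L ! 1 = m"
    using cycle_list_from[OF m Bm[OF a(1)] a] by blast
  have adj: "cadj L x y \<longleftrightarrow> x \<le> m \<and> y \<le> m \<and> (consec x y \<or> {x, y} = {0, m})" for x y
    by (simp only: L(4) cadj_upt[OF m])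
  have adj_lt: "cadj L x y \<longleftrightarrow> consec x y" if "x < m" "y < m" for x y
    using that by (auto simp: adj doubleton_eq_iff)
  interpret star_cycle L B T' s m
  proof
    show "i = m \<or> i \<in> T'" if "b \<in> B" "cadj L b i" for b i
    proof (cases "i = m")
      case False
      then have "i < m" using that(2) by (auto simp: adj)
      then have "consec b i" using that adj_lt Bm by simp
      then show ?thesis using B(1) that(1) \<open>i < m\<close> by (auto simp: closed_def T'_def)
    qed simp
    show "L ! 1 = m" if "b \<in> B" "cadj L b m" for b
    proof -
      have "b = 0 \<or> b = m - 1"
        using that(2) Bm[OF that(1)] by (auto simp: adj consec_def doubleton_eq_iff)
      then show ?thesis using L(6) that(1) by blast
    qed
    show "\<not> cadj L b c" if "b \<in> B" "c \<in> B" for b c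
      using that adj_lt[OF Bm Bm] indepA BA by (auto simp: consec_def)
    show "\<not> cadj L i (s i)" if "i \<in> T'" for i
      using that adj_lt[OF T'm Bm] s by (auto simp: T'_def)
    show "B \<subseteq> set L" "T' \<subseteq> set L" using L(2) Bm T'm by (auto simp: less_imp_le)
    show "B \<inter> T' = {}" using BA(1) T(2) by (auto simp: T'_def)
    show "m \<notin> B" "m \<notin> T'" using Bm T'm by blast+
    show "3 \<le> length L" using L(3) m by simp
    show "s i \<in> B" if "i \<in> T'" for i using that by (simp add: T'_def)
    show "hd L \<in> B" using L(5) a(1) by simp
    show "m \<in> set L" by (simp add: L(2))
  qed (rule L(1))
  obtain Q where Q: "Q \<in> ham_paths E (set L) (hd L) (L ! 1)" "E (last Q) (hd L)" "Q \<noteq> L"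
    using second_ham_cycle .
  note props = ham_path_props[OF Q(1)]
  have Qne: "Q \<noteq> []" using props(3) L_nonempty by auto
  have D_E: "E x y" if "cadj Q x y" for x y
    using that cedge_iff_successively[OF Qne, of E] props(4,7) Q(2) E_sym
    by (auto simp: cadj_def)
  have "\<exists>c\<in>B. card {y. cadj Q c y \<and> \<not> cadj L c y} = 1"
  proof (rule vertex_with_single_star_edge[OF Q])
    fix C assume C: "C \<subset> B" "C \<noteq> {}"
    then have "\<not> closed C" using B(2) by blast
    then obtain c i where c: "c \<in> C" "i < m" "consec c i" "\<not> (i \<in> T \<and> s i \<in> C)"
      using C BA by (auto simp: closed_def)
    then have "cadj L c i" using adj_lt Bm C by blast
    then show "\<exists>c\<in>C. \<exists>i. cadj L c i \<and> i \<noteq> m \<and> \<not> (i \<in> T' \<and> s i \<in> C)"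
      using c by (auto simp: T'_def)
  qed
  then obtain c where c: "c \<in> B" "card {y. cadj Q c y \<and> \<not> cadj L c y} = 1" by blast
  obtain k D0 where r: "rotate k Q = m # D0"
    using rotate_to_front[of m Q] props(6) L(2) by auto
  have "length (m # D0) = length Q" by (simp only: r[symmetric] length_rotate)
  then have D0: "distinct (m # D0)" "set (m # D0) = {..m}" "cadj (m # D0) = cadj Q" "length D0 = m"
    using props(3,5,6) L(2,3) distinct_rotate[of k Q] set_rotate[of k Q] cadj_rotate[of k Q]
    by (simp_all add: r)
  have m_nbrs: "cadj L m y" if "cadj Q m y" for y
    using D_E[OF that] Bm T'm sA by (force simp: E_def star_def)
  have "{y. cadj Q m y} = {y. cadj L m y}"
  proof (rule card_subset_eq)
    have mL: "m \<in> set L" by (simp add: L(2))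
    show "card {y. cadj Q m y} = card {y. cadj L m y}"
      using card_cadj_nbrs[OF dist len mL] card_cadj_nbrs[of Q m] props(3,5,6) len mL by simp
    show "finite {y. cadj L m y}"
      by (rule finite_subset[of _ "{..m}"]) (auto simp: adj)
    show "{y. cadj Q m y} \<subseteq> {y. cadj L m y}" using m_nbrs by blast
  qed
  also have "\<dots> = {0, m - 1}"
    using m by (auto simp: adj consec_def doubleton_eq_iff)
  finally have ends: "{hd D0, last D0} = {0, m - 1}"
    using cadj_Cons_nbrs[OF D0(1)] D0(3,4) m by simp
  \<comment> \<open>The cycle may have been cut open in the wrong direction.\<close>
  define D where "D = (if hd D0 = 0 then D0 else rev D0)"
  have D0ne: "D0 \<noteq> []" using D0(4) m by auto
  have D: "distinct (m # D)" "set D = {..<m}" "cadj (m # D) = cadj Q" "length D = m"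
  proof -
    have "set D0 = insert m (set D0) - {m}" using D0(1) by auto
    also have "\<dots> = {..m} - {m}" using D0(2) by simp
    also have "\<dots> = {..<m}" by (simp add: lessThan_def atMost_def set_eq_iff) linarith
    finally show "set D = {..<m}" by (simp add: D_def)
    show "cadj (m # D) = cadj Q" using D0(3) cadj_Cons_rev[of m D0] by (simp add: D_def)
  qed (use D0 in \<open>auto simp: D_def\<close>)
  have "hd D = 0" "last D = m - 1"
  proof -
    have "0 \<noteq> m - 1" using m by simp
    then show "hd D = 0" "last D = m - 1"
      using ends D0ne unfolding D_def doubleton_eq_iff by (cases "hd D0 = 0"; simp add: hd_rev last_rev)+
  qed
  have Dm: "D ! p < m" if "p < m" for p using nth_mem[of p D] that D(2,4) by auto
  have Dadj: "cadj Q (D ! p) (D ! q) \<longleftrightarrow> consec p q" if "p < m" "q < m" for p q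
    using cadj_Cons_nth[OF D(1)] that D(3,4) by simp
  have DL: "cadj L (D ! p) (D ! q) \<longleftrightarrow> consec (D ! p) (D ! q)" if "p < m" "q < m" for p q
    using that by (intro adj_lt Dm)
  have steps: "consec (D ! p) (D ! Suc p)
       \<or> D ! p \<in> T \<and> s (D ! p) = D ! Suc p \<or> D ! Suc p \<in> T \<and> s (D ! Suc p) = D ! p" if "Suc p < m" for p
  proof -
    have "cadj Q (D ! p) (D ! Suc p)" using Dadj[of p "Suc p"] that by (simp add: consec_def)
    then have "cadj L (D ! p) (D ! Suc p) \<or> star (D ! p) (D ! Suc p)"
      using D_E unfolding E_def by blast
    moreover have "cadj L (D ! p) (D ! Suc p) \<longleftrightarrow> consec (D ! p) (D ! Suc p)"
      using that by (intro DL) auto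
    ultimately show ?thesis unfolding star_def by (auto simp: T'_def)
  qed
  obtain p where p: "p < m" "D ! p = c"
  proof -
    have "c \<in> set D" using Bm[OF c(1)] D(2) by simp
    then show thesis using that D(4) by (auto simp: in_set_conv_nth)
  qed
  let ?S = "{y. cadj Q c y \<and> \<not> cadj L c y}"
  let ?l = "0 < p \<and> \<not> consec (D ! (p - 1)) (D ! p)" and ?r = "Suc p < m \<and> \<not> consec (D ! p) (D ! Suc p)"
  \<comment> \<open>The new edges at \<open>c\<close> are its non-consecutive steps in
    \<open>D\<close>; an edge to \<open>m\<close> is never new.\<close>
  have S: "?S = (if ?l then {D ! (p - 1)} else {}) \<union> (if ?r then {D ! Suc p} else {})"
  proof -
    have "y \<in> ?S \<longleftrightarrow> (?l \<and> y = D ! (p - 1)) \<or> (?r \<and> y = D ! Suc p)" for y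
    proof
      assume y: "y \<in> ?S"
      then have "y \<in> set Q" "y \<noteq> m"
        using cadj_in_set[of Q c y] m_nbrs[of c] cadj_sym[of Q c y] cadj_sym[of L c y] by auto
      then have "y \<in> set D" using props(6) L(2) D(2) by auto
      then obtain q where q: "q < m" "y = D ! q" using D(4) by (auto simp: in_set_conv_nth)
      then have "consec p q" using y Dadj[of p q] p by simp
      moreover have "\<not> consec (D ! p) (D ! q)" using y DL[of p q] p q by simp
      ultimately show "(?l \<and> y = D ! (p - 1)) \<or> (?r \<and> y = D ! Suc p)"
      proof (cases "q = Suc p")
        case True
        then show ?thesis using q \<open>\<not> consec (D ! p) (D ! q)\<close> by blast
      next
        case False
        then have "p = Suc q" using \<open>consec p q\<close> by (simp add: consec_def)
        then show ?thesis
          using q \<open>\<not> consec (D ! p) (D ! q)\<close> consec_sym[of "D ! p" "D ! q"] by simp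
      qed
    next
      assume "(?l \<and> y = D ! (p - 1)) \<or> (?r \<and> y = D ! Suc p)"
      then obtain q where q: "q < m" "consec p q" "y = D ! q" "\<not> consec (D ! p) (D ! q)"
      proof
        assume "?l \<and> y = D ! (p - 1)"
        then show thesis
          using that[of "p - 1"] p(1) consec_sym[of "D ! p" "D ! (p - 1)"] by (simp add: consec_def[of p])
      next
        assume "?r \<and> y = D ! Suc p"
        then show thesis using that[of "Suc p"] by (simp add: consec_def[of p])
      qed
      then show "y \<in> ?S" using Dadj[of p q] DL[of p q] p by simp
    qed
    then show ?thesis by (auto split: if_splits)
  qed
  have ne: "D ! (p - 1) \<noteq> D ! Suc p" if "Suc p < m"
    using that D(1,4) by (simp add: nth_eq_iff_index_eq)
  have "?l \<noteq> ?r"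
  proof
    assume eq: "?l = ?r"
    show False
    proof (cases ?l)
      case True
      then have r: ?r using eq by blast
      have "?S = {D ! (p - 1)} \<union> {D ! Suc p}" using S unfolding if_P[OF True] if_P[OF r] .
      moreover have "D ! (p - 1) \<noteq> D ! Suc p" using ne r by blast
      ultimately have "card ?S = 2" by (simp only: Un_insert_left Un_empty_left card_2_iff) blast
      then show False using c(2) by linarith
    next
      case False
      then have r: "\<not> ?r" using eq by blast
      have "?S = {}" using S unfolding if_not_P[OF False] if_not_P[OF r] Un_empty_right .
      then have "card ?S = 0" by (simp only: card.empty)
      then show False using c(2) by linarith
    qed
  qed
  moreover have "D ! p \<in> A" using p c(1) BA by blast
  ultimately show thesis
    using that[of D] D(1,2) \<open>hd D = 0\<close> \<open>last D = m - 1\<close> steps p(1) by auto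
qed

section \<open>Longest paths\<close>

definition conn :: "('a \<Rightarrow> 'a \<Rightarrow> bool) \<Rightarrow> 'a set \<Rightarrow> ('a \<times> 'a) set" where
  "conn N U = {(u, v). u \<in> U \<and> v \<in> U \<and> N u v}\<^sup>*"

lemma conn_sym: "symp N \<Longrightarrow> (u, v) \<in> conn N U \<Longrightarrow> (v, u) \<in> conn N U"
  unfolding conn_def
  by (rule symD[OF sym_rtrancl]) (auto simp: sym_def symp_def)

lemma conn_trans: "(u, v) \<in> conn N U \<Longrightarrow> (v, w) \<in> conn N U \<Longrightarrow> (u, w) \<in> conn N U"
  unfolding conn_def by (rule rtrancl_trans)

lemma conn_refl: "(u, u) \<in> conn N U"
  by (simp add: conn_def)

lemma conn_step: "u \<in> U \<Longrightarrow> v \<in> U \<Longrightarrow> N u v \<Longrightarrow> (u, v) \<in> conn N U"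
  unfolding conn_def by (rule r_into_rtrancl) simp

lemma conn_in: "(u, v) \<in> conn N U \<Longrightarrow> u \<in> U \<Longrightarrow> v \<in> U"
  unfolding conn_def by (induction rule: rtrancl_induct) auto

lemma conn_path:
  assumes "(u, v) \<in> conn N U"
  obtains b where "b \<noteq> []" "distinct b" "successively N b" "hd b = u" "last b = v"
    "\<And>w. w \<in> set b \<Longrightarrow> (u, w) \<in> conn N U"
proof -
  have "\<exists>b. b \<noteq> [] \<and> distinct b \<and> successively N b \<and> hd b = u \<and> last b = v \<and>
      (\<forall>w\<in>set b. (u, w) \<in> conn N U)"
    using assms unfolding conn_def
  proof (induction rule: rtrancl_induct)
    case base
    show ?case by (intro exI[of _ "[u]"]) simp
  next
    case (step v w)
    then obtain b where b: "b \<noteq> []" "distinct b" "successively N b" "hd b = u" "last b = v"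
      "\<forall>w\<in>set b. (u, w) \<in> {(u, v). u \<in> U \<and> v \<in> U \<and> N u v}\<^sup>*" by blast
    show ?case
    proof (cases "w \<in> set b")
      case True
      then obtain ys zs where "b = ys @ w # zs" by (meson split_list)
      then have "b = (ys @ [w]) @ zs" by simp
      then have "distinct (ys @ [w])" "successively N (ys @ [w])" "hd (ys @ [w]) = u" "set (ys @ [w]) \<subseteq> set b"
        using b by (auto simp: successively_append_iff hd_append split: if_splits)
      then show ?thesis using b(6) by (intro exI[of _ "ys @ [w]"]) auto
    next
      case False
      have "(u, w) \<in> {(u, v). u \<in> U \<and> v \<in> U \<and> N u v}\<^sup>*" using step(1,2) by (rule rtrancl_into_rtrancl)
      then show ?thesis
        using b False step(2)
        by (intro exI[of _ "b @ [w]"]) (auto simp: successively_append_iff)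
    qed
  qed
  then show thesis using that by blast
qed

lemma concat_blocks:
  assumes "\<And>p. p < m \<Longrightarrow> f p \<noteq> [] \<and> distinct (f p) \<and> successively N (f p)"
    and "\<And>p. Suc p < m \<Longrightarrow> N (last (f p)) (hd (f (Suc p)))"
    and "\<And>p q. p < q \<Longrightarrow> q < m \<Longrightarrow> set (f p) \<inter> set (f q) = {}"
    and "0 < m"
  defines "W \<equiv> concat (map f [0..<m])"
  shows "W \<noteq> []" "distinct W" "successively N W" "hd W = hd (f 0)" "last W = last (f (m - 1))"
    "length W = (\<Sum>p<m. length (f p))" "set W = (\<Union>p<m. set (f p))"
proof -
  have *: "concat (map f [0..<Suc k]) \<noteq> [] \<and> distinct (concat (map f [0..<Suc k])) \<and>
      successively N (concat (map f [0..<Suc k])) \<and> hd (concat (map f [0..<Suc k])) = hd (f 0) \<and>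
      last (concat (map f [0..<Suc k])) = last (f k)" if "Suc k \<le> m" for k
    using that
  proof (induction k)
    case 0
    then show ?case using assms(1)[of 0] by simp
  next
    case (Suc k)
    define X where "X = concat (map f [0..<Suc k])"
    have X: "X \<noteq> []" "distinct X" "successively N X" "hd X = hd (f 0)" "last X = last (f k)"
      using Suc by (simp_all add: X_def)
    have f: "f (Suc k) \<noteq> []" "distinct (f (Suc k))" "successively N (f (Suc k))"
      using assms(1)[of "Suc k"] Suc.prems by auto
    have "set X \<inter> set (f (Suc k)) = {}"
    proof -
      have "set X = (\<Union>p\<in>{0..<Suc k}. set (f p))" unfolding X_def by (auto simp del: upt_Suc)
      moreover have "set (f p) \<inter> set (f (Suc k)) = {}" if "p \<in> {0..<Suc k}" for p
        using assms(3)[of p "Suc k"] that Suc.prems by simp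
      ultimately show ?thesis by blast
    qed
    moreover have eq: "concat (map f [0..<Suc (Suc k)]) = X @ f (Suc k)" by (simp add: X_def)
    ultimately show ?case
      unfolding eq using X f assms(2)[of k] Suc.prems by (simp add: successively_append_iff)
  qed
  from *[of "m - 1"] assms(4)
  show "W \<noteq> []" "distinct W" "successively N W" "hd W = hd (f 0)" "last W = last (f (m - 1))"
    by (simp_all add: W_def)
  show "set W = (\<Union>p<m. set (f p))" by (auto simp: W_def)
  show "length W = (\<Sum>p<m. length (f p))"
    by (simp add: W_def length_concat comp_def interv_sum_list_conv_sum_set_nat atLeast0LessThan)
qed

text \<open>A centre \<open>a\<close> carries the component \<open>C a\<close> of
  \<open>t a\<close>, and components of different centres are disjoint. A centre without new edges
  is kept. With one new edge, a path through \<open>C a\<close> is put next to it, a gain of at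
  least one vertex. With two, it is bypassed by a path in \<open>C a\<close>, which may be a single
  vertex. So no block is empty, and a centre with exactly one new edge makes the total
  larger.\<close>

lemma longer_path_from_star_path:
  fixes r t :: "nat \<Rightarrow> 'a" and A T :: "nat set" and s :: "nat \<Rightarrow> nat"
  assumes N: "symp N" and m: "2 \<le> m" and inj: "inj_on r {..<m}"
    and path: "\<And>i. Suc i < m \<Longrightarrow> N (r i) (r (Suc i))"
    and A: "A \<subseteq> {..<m}" "A \<noteq> {}" and indepA: "\<And>a. a \<in> A \<Longrightarrow> Suc a \<notin> A"
    and T: "T \<subseteq> {..<m}" "A \<inter> T = {}"
    and s: "\<And>i. i \<in> T \<Longrightarrow> s i \<in> A \<and> \<not> consec i (s i)"
    and nbr: "\<And>a i. a \<in> A \<Longrightarrow> i < m \<Longrightarrow> consec a i \<Longrightarrow> i \<in> T"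
    and U: "\<And>i. i < m \<Longrightarrow> r i \<notin> U"
    and t: "\<And>i. i \<in> A \<union> T \<Longrightarrow> t i \<in> U \<and> N (r i) (t i)"
    and comp_s: "\<And>i. i \<in> T \<Longrightarrow> (t (s i), t i) \<in> conn N U"
    and comp_A: "\<And>a b. a \<in> A \<Longrightarrow> b \<in> A \<Longrightarrow> a \<noteq> b \<Longrightarrow> (t a, t b) \<notin> conn N U"
  obtains W where "W \<noteq> []" "distinct W" "successively N W" "hd W = r 0" "last W = r (m - 1)"
    "set W \<subseteq> r ` {..<m} \<union> U" "m < length W"
proof -
  obtain D where D: "distinct D" "set D = {..<m}" "hd D = 0" "last D = m - 1"
    and steps': "\<forall>p. Suc p < m \<longrightarrow> consec (D ! p) (D ! Suc p)
       \<or> D ! p \<in> T \<and> s (D ! p) = D ! Suc p \<or> D ! Suc p \<in> T \<and> s (D ! Suc p) = D ! p"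
    and single: "\<exists>p<m. D ! p \<in> A \<and>
      (0 < p \<and> \<not> consec (D ! (p - 1)) (D ! p)) \<noteq> (Suc p < m \<and> \<not> consec (D ! p) (D ! Suc p))"
    by (rule reroute_star_path[of m A T s]) (use m A T indepA s nbr that in blast)+
  note steps = steps'[rule_format]
  have lenD: "length D = m" using D(1,2) distinct_card[of D] by simp
  have Dm: "D ! p < m" if "p < m" for p using nth_mem[of p D] that D(2) lenD by auto
  \<comment> \<open>\<open>inl\<close> and \<open>inr\<close> say that the edge entering,
    respectively leaving, position \<open>p\<close> is new.\<close>
  define inl where "inl p \<longleftrightarrow> 0 < p \<and> \<not> consec (D ! (p - 1)) (D ! p)" for p
  define inr where "inr p \<longleftrightarrow> Suc p < m \<and> \<not> consec (D ! p) (D ! Suc p)" for p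
  define C where "C a = {v. (t a, v) \<in> conn N U}" for a
  have CU: "C a \<subseteq> U" if "a \<in> A" for a
    using conn_in[of "t a" _ N U] t[of a] that by (auto simp: C_def)
  \<comment> \<open>The admissible blocks at position \<open>p\<close>: a new edge attaches inside
    the component, an old one at the path vertex itself.\<close>
  define good where "good p b \<longleftrightarrow> b \<noteq> [] \<and> distinct b \<and> successively N b \<and>
    set b \<subseteq> insert (r (D ! p)) (if D ! p \<in> A then C (D ! p) else {}) \<and>
    (\<not> inl p \<longrightarrow> hd b = r (D ! p)) \<and> (\<not> inr p \<longrightarrow> last b = r (D ! p)) \<and>
    (D ! p \<notin> A \<longrightarrow> b = [r (D ! p)]) \<and>
    (D ! p \<in> A \<longrightarrow> (inl p \<longrightarrow> N (r (D ! (p - 1))) (hd b)) \<and> (inr p \<longrightarrow> N (last b) (r (D ! Suc p))) \<and>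
      (inl p \<noteq> inr p \<longrightarrow> 2 \<le> length b))" for p b
  have "\<exists>b. good p b" if p: "p < m" for p
  proof (cases "D ! p \<in> A")
    case False
    then show ?thesis by (intro exI[of _ "[r (D ! p)]"]) (simp add: good_def)
  next
    case True
    define a where "a = D ! p"
    have aA: "a \<in> A" and ta: "t a \<in> U" "N (r a) (t a)" and raU: "r a \<notin> U"
      using True t[of a] U[of a] Dm[OF p] by (auto simp: a_def)
    have conn_C: "\<exists>b. b \<noteq> [] \<and> distinct b \<and> successively N b \<and> hd b = u \<and> last b = v \<and> set b \<subseteq> C a"
      if uv: "u \<in> C a" "v \<in> C a" for u v
    proof -
      have "(u, v) \<in> conn N U"
        using conn_trans[OF conn_sym[OF N, of "t a" u U]] uv by (simp add: C_def)
      then obtain b where b: "b \<noteq> []" "distinct b" "successively N b" "hd b = u" "last b = v"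
        "\<And>w. w \<in> set b \<Longrightarrow> (u, w) \<in> conn N U" by (rule conn_path) blast
      have "set b \<subseteq> C a"
        using conn_trans[of "t a" u N U] b(6) uv(1) by (auto simp: C_def)
      then show ?thesis using b(1-5) by blast
    qed
    \<comment> \<open>As \<open>a\<close> is in \<open>A\<close> and hence not in \<open>T\<close>,
      a new edge at \<open>a\<close> is the star edge of its other end.\<close>
    have left: "D ! (p - 1) \<in> T \<and> s (D ! (p - 1)) = a" if "inl p"
      using steps[of "p - 1"] that p aA T(2) by (auto simp: inl_def a_def)
    have right: "D ! Suc p \<in> T \<and> s (D ! Suc p) = a" if "inr p"
      using steps[of p] that p aA T(2) by (auto simp: inr_def a_def)
    have CT: "t i \<in> C a" "N (r i) (t i)" if "i \<in> T \<and> s i = a" for i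
      using comp_s[of i] t[of i] that by (auto simp: C_def)
    have taC: "t a \<in> C a" by (simp add: C_def conn_refl)
    have raC: "r a \<notin> C a" using CU[OF aA] raU by blast
    have N': "N v u" if "N u v" for u v using N that by (auto simp: symp_def)
    consider "\<not> inl p" "\<not> inr p" | "inl p" "\<not> inr p" | "\<not> inl p" "inr p" | "inl p" "inr p" by blast
    then show ?thesis
    proof cases
      case 1
      then show ?thesis by (intro exI[of _ "[r a]"]) (simp add: good_def a_def)
    next
      case 2
      note i = CT[OF left[OF 2(1)]]
      obtain b where "b \<noteq> []" "distinct b" "successively N b" "hd b = t (D ! (p - 1))" "last b = t a" "set b \<subseteq> C a"
        using conn_C[OF i(1) taC] by blast
      then have "good p (b @ [r a])"
        using 2 i(2) N'[OF ta(2)] raC aA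
        by (auto simp: good_def a_def[symmetric] successively_append_iff numeral_2_eq_2 Suc_le_eq)
      then show ?thesis by blast
    next
      case 3
      note i = CT[OF right[OF 3(2)]]
      obtain b where "b \<noteq> []" "distinct b" "successively N b" "hd b = t a" "last b = t (D ! Suc p)" "set b \<subseteq> C a"
        using conn_C[OF taC i(1)] by blast
      then have "good p (r a # b)"
        using 3 N'[OF i(2)] ta(2) raC aA
        by (cases b) (auto simp: good_def a_def[symmetric])
      then show ?thesis by blast
    next
      case 4
      note i = CT[OF left[OF 4(1)]] and j = CT[OF right[OF 4(2)]]
      obtain b where "b \<noteq> []" "distinct b" "successively N b" "hd b = t (D ! (p - 1))" "last b = t (D ! Suc p)"
        "set b \<subseteq> C a"
        using conn_C[OF i(1) j(1)] by blast
      then have "good p b"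
        using 4 i(2) N'[OF j(2)] aA by (auto simp: good_def a_def[symmetric])
      then show ?thesis by blast
    qed
  qed
  then obtain f where f: "\<And>p. p < m \<Longrightarrow> good p (f p)" by metis
  define W where "W = concat (map f [0..<m])"
  have disj: "set (f p) \<inter> set (f q) = {}" if "p < q" "q < m" for p q
  proof -
    have Dpq: "D ! p \<noteq> D ! q" using that D(1) lenD by (simp add: nth_eq_iff_index_eq)
    have m': "D ! p < m" "D ! q < m" using that Dm by auto
    have "r (D ! p) \<noteq> r (D ! q)" using inj Dpq m' by (auto simp: inj_on_def)
    moreover have "C (D ! p) \<inter> C (D ! q) = {}" if "D ! p \<in> A" "D ! q \<in> A"
      using comp_A[OF that Dpq] conn_trans[OF _ conn_sym[OF N], of "t (D ! p)" _ U "t (D ! q)"]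
      by (auto simp: C_def)
    moreover have "set (f p) \<subseteq> insert (r (D ! p)) (if D ! p \<in> A then C (D ! p) else {})"
      "set (f q) \<subseteq> insert (r (D ! q)) (if D ! q \<in> A then C (D ! q) else {})"
      using f[of p] f[of q] that by (auto simp: good_def)
    moreover have "r (D ! p) \<notin> U" "r (D ! q) \<notin> U" using U m' by auto
    ultimately show ?thesis
      using CU[of "D ! p"] CU[of "D ! q"] by (cases "D ! p \<in> A"; cases "D ! q \<in> A"; simp) blast+
  qed
  have junction: "N (last (f p)) (hd (f (Suc p)))" if p: "Suc p < m" for p
  proof -
    have g: "good p (f p)" "good (Suc p) (f (Suc p))" using f p by auto
    consider "consec (D ! p) (D ! Suc p)"
      | "\<not> consec (D ! p) (D ! Suc p)" "D ! p \<in> T" "s (D ! p) = D ! Suc p"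
      | "\<not> consec (D ! p) (D ! Suc p)" "D ! Suc p \<in> T" "s (D ! Suc p) = D ! p"
      using steps[OF p] by blast
    then show ?thesis
    proof cases
      case 1
      then have "\<not> inr p" "\<not> inl (Suc p)" by (auto simp: inl_def inr_def)
      then have "last (f p) = r (D ! p)" "hd (f (Suc p)) = r (D ! Suc p)"
        using g by (auto simp: good_def)
      moreover have "D ! p < m" "D ! Suc p < m" using Dm p by auto
      ultimately show ?thesis
        using 1 path[of "D ! p"] path[of "D ! Suc p"] N by (auto simp: consec_def symp_def)
    next
      case 2
      then have "inl (Suc p)" "D ! Suc p \<in> A" "D ! p \<notin> A"
        using s[of "D ! p"] T(2) by (auto simp: inl_def)
      then show ?thesis using g by (auto simp: good_def)
    next
      case 3
      then have "inr p" "D ! p \<in> A" "D ! Suc p \<notin> A"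
        using s[of "D ! Suc p"] T(2) p by (auto simp: inr_def)
      then show ?thesis using g by (auto simp: good_def)
    qed
  qed
  have blocks: "f p \<noteq> [] \<and> distinct (f p) \<and> successively N (f p)" if "p < m" for p
    using f[OF that] by (simp add: good_def)
  have m0: "0 < m" using m by simp
  note W = concat_blocks[of m f N, OF blocks junction disj m0, folded W_def]
  have Dne: "D \<noteq> []" using lenD m by auto
  have "hd W = r 0"
  proof -
    have "\<not> inl 0" by (simp add: inl_def)
    then show ?thesis using W(4) f[OF m0] D(3) Dne by (simp add: good_def hd_conv_nth)
  qed
  moreover have "last W = r (m - 1)"
  proof -
    have "\<not> inr (m - 1)" using m0 by (simp add: inr_def)
    then show ?thesis using W(5) f[of "m - 1"] m0 D(4) Dne lenD by (simp add: good_def last_conv_nth)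
  qed
  moreover have "set W \<subseteq> r ` {..<m} \<union> U"
  proof -
    have "set (f p) \<subseteq> r ` {..<m} \<union> U" if "p < m" for p
    proof -
      have "set (f p) \<subseteq> insert (r (D ! p)) (if D ! p \<in> A then C (D ! p) else {})"
        using f[OF that] by (simp add: good_def)
      then show ?thesis using CU[of "D ! p"] Dm[OF that] by (auto split: if_splits)
    qed
    then show ?thesis by (auto simp: W(7))
  qed
  moreover have "m < length W"
  proof -
    obtain p where p: "p < m" "D ! p \<in> A" "inl p \<noteq> inr p"
      using single unfolding inl_def inr_def by blast
    have "(\<Sum>p<m. 1) < (\<Sum>p<m. length (f p))"
    proof (rule sum_strict_mono_ex1)
      show "\<forall>p\<in>{..<m}. 1 \<le> length (f p)" using blocks by (auto simp: Suc_le_eq)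
      have "2 \<le> length (f p)" using f[OF p(1)] p by (simp add: good_def)
      then show "\<exists>p\<in>{..<m}. 1 < length (f p)" using p(1) by (intro bexI[of _ p]) simp_all
    qed simp
    then show ?thesis by (simp add: W(6))
  qed
  ultimately show thesis using W(1-3) by (intro that[of W])
qed

section \<open>Cubic 3-connected graphs and a cycle through a longest path\<close>

lemma cadj_ends: "P \<noteq> [] \<Longrightarrow> cadj P (last P) (hd P)"
  unfolding cadj_def cedge_nth
  by (intro disjI1 exI[of _ "length P - 1"]) (simp add: last_conv_nth hd_conv_nth)

text \<open>Adjacency is a plain relation here. \<open>cut\<close> expresses 3-connectivity by
  edges: after deleting fewer than three vertices, every proper nonempty part still has an edge
  leaving it.\<close>

locale cubic_net =
  fixes V :: "'a set" and N :: "'a \<Rightarrow> 'a \<Rightarrow> bool"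
  assumes finV: "finite V" and cardV: "3 < card V"
    and symN: "symp N" and irreflN: "\<not> N v v" and N_in: "N u v \<Longrightarrow> u \<in> V"
    and deg: "v \<in> V \<Longrightarrow> card {u. N v u} = 3"
    and cut: "S \<subseteq> V \<Longrightarrow> card S < 3 \<Longrightarrow> C \<subseteq> V - S \<Longrightarrow> C \<noteq> {} \<Longrightarrow> C \<noteq> V - S \<Longrightarrow>
      \<exists>u\<in>C. \<exists>v\<in>V - S - C. N u v"
begin

lemma N_sym: "N u v \<Longrightarrow> N v u"
  using symN by (simp add: symp_def)

lemma N_in': "N u v \<Longrightarrow> v \<in> V"
  using N_sym N_in by blast

definition net_path :: "'a \<Rightarrow> 'a \<Rightarrow> 'a list \<Rightarrow> bool" where
  "net_path x y q \<longleftrightarrow> q \<noteq> [] \<and> distinct q \<and> set q \<subseteq> V \<and> successively N q \<and> hd q = x \<and> last q = y"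

definition longest :: "'a \<Rightarrow> 'a \<Rightarrow> 'a list \<Rightarrow> bool" where
  "longest x y P \<longleftrightarrow> net_path x y P \<and> (\<forall>q. net_path x y q \<longrightarrow> length q \<le> length P)"

lemma net_path_rev: "net_path x y q \<Longrightarrow> net_path y x (rev q)"
proof -
  assume q: "net_path x y q"
  then have "successively N q" by (simp add: net_path_def)
  then have "successively (\<lambda>u v. N v u) q" by (rule successively_mono) (rule N_sym)
  then show "net_path y x (rev q)"
    using q by (simp add: net_path_def successively_rev hd_rev last_rev)
qed

lemma longest_rev: "longest x y P \<Longrightarrow> longest y x (rev P)"
  unfolding longest_def using net_path_rev by (metis length_rev)

text \<open>Deleting \<open>x\<close> leaves a connected graph, so another neighbour of
  \<open>x\<close> is joined to \<open>y\<close> without using \<open>x\<close>. Hence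
  \<open>P\<close> is not the edge itself and closes to a genuine cycle.\<close>

lemma longest_path_length:
  assumes "longest x y P" "N x y"
  shows "3 \<le> length P"
proof -
  have x: "x \<in> V" "x \<noteq> y" using assms(2) N_in irreflN by auto
  have "card ({u. N x u} - {y}) = 2" using deg[OF x(1)] assms(2) by (simp add: card_Diff_singleton)
  then have "{u. N x u} - {y} \<noteq> {}" by (metis card.empty zero_neq_numeral)
  then obtain c where c: "N x c" "c \<noteq> y" by blast
  define C where "C = {v. (c, v) \<in> conn N (V - {x})}"
  have cx: "c \<in> V - {x}" using c N_in' irreflN by auto
  have CV: "C \<subseteq> V - {x}" using conn_in[of c _ N "V - {x}"] cx by (auto simp: C_def)
  have "C = V - {x}"
  proof (rule ccontr)
    assume "C \<noteq> V - {x}"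
    moreover have "c \<in> C" by (simp add: C_def conn_refl)
    ultimately obtain u v where "u \<in> C" "v \<in> V - {x} - C" "N u v"
      using cut[of "{x}" C] CV x by auto
    moreover from this have "(u, v) \<in> conn N (V - {x})" using CV by (intro conn_step) auto
    ultimately show False using conn_trans[of c u N "V - {x}" v] by (simp add: C_def)
  qed
  moreover have "y \<in> V - {x}" using assms(2) N_in' x by auto
  ultimately have "(c, y) \<in> conn N (V - {x})" by (auto simp: C_def)
  then obtain b where b: "b \<noteq> []" "distinct b" "successively N b" "hd b = c" "last b = y"
    "\<And>w. w \<in> set b \<Longrightarrow> (c, w) \<in> conn N (V - {x})" by (rule conn_path) blast
  have "set b \<subseteq> V - {x}" using b(6) CV by (auto simp: C_def)
  then have "net_path x y (x # b)"
    using b c x by (cases b) (auto simp: net_path_def)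
  then have "length (x # b) \<le> length P" using assms(1) longest_def by blast
  moreover have "2 \<le> length b" using b(1,4,5) c(2) by (cases b; cases "tl b") auto
  ultimately show ?thesis by simp
qed

end

locale longest_net_path = cubic_net +
  fixes x y :: 'a and P :: "'a list"
  assumes longest: "longest x y P" and xy: "N x y"
begin

lemma P: "P \<noteq> []" "distinct P" "set P \<subseteq> V" "successively N P" "hd P = x" "last P = y"
  using longest by (auto simp: longest_def net_path_def)

lemma len: "3 \<le> length P"
  by (rule longest_path_length[OF longest xy])

lemma not_longer: "net_path x y q \<Longrightarrow> length q \<le> length P"
  using longest by (simp add: longest_def)

lemma cadj_N: "cadj P u v \<Longrightarrow> N u v"
  using cedge_iff_successively[OF P(1), of N] P(4-6) xy N_sym by (auto simp: cadj_def)

text \<open>The closed cycle uses two of the three edges at each vertex of \<open>P\<close>; this is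
  the far end of the remaining one. \<open>cadj P\<close> includes the closing edge between the
  ends.\<close>

definition third :: "'a \<Rightarrow> 'a" where
  "third v = (THE u. N v u \<and> \<not> cadj P v u)"

lemma third: "N v (third v) \<and> \<not> cadj P v (third v)"
  and third_unique: "N v u \<Longrightarrow> \<not> cadj P v u \<Longrightarrow> u = third v" if v: "v \<in> set P"
proof -
  have fin: "finite {u. cadj P v u}" "card {u. cadj P v u} = 2"
    using card_cadj_nbrs[OF P(2) len v] card_ge_0_finite[of "{u. cadj P v u}"] by simp_all
  have "v \<in> V" "{u. cadj P v u} \<subseteq> {u. N v u}" using P(3) v cadj_N by auto
  then have "card ({u. N v u} - {u. cadj P v u}) = 1"
    using card_Diff_subset[OF fin(1), of "{u. N v u}"] fin(2) deg by simp
  then obtain w where w: "{u. N v u} - {u. cadj P v u} = {w}" by (auto simp: card_1_singleton_iff)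
  then have *: "N v u \<and> \<not> cadj P v u \<longleftrightarrow> u = w" for u by blast
  then have "third v = w" by (simp add: third_def)
  then show "N v (third v) \<and> \<not> cadj P v (third v)"
    and "N v u \<Longrightarrow> \<not> cadj P v u \<Longrightarrow> u = third v" using * by auto
qed

definition outer :: "'a set" where "outer = V - set P"

abbreviation "linked \<equiv> conn N outer"

definition bound :: "'a \<Rightarrow> bool" where
  "bound v \<longleftrightarrow> {u. N v u} \<subseteq> set P"

lemma bound_iff: "v \<in> set P \<Longrightarrow> bound v \<longleftrightarrow> third v \<in> set P"
  unfolding bound_def using third third_unique cadj_in_set by (metis mem_Collect_eq subset_iff)

lemma third_outer: "v \<in> set P \<Longrightarrow> \<not> bound v \<Longrightarrow> third v \<in> outer"
  using third[of v] N_in' bound_iff by (auto simp: outer_def)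

text \<open>Bound vertices come in pairs, the two ends of a chord of the cycle.\<close>

lemma third_third:
  assumes "v \<in> set P" "bound v"
  shows "third v \<in> set P" "bound (third v)" "third (third v) = v" "third v \<noteq> v"
proof -
  show t: "third v \<in> set P" using assms bound_iff by simp
  have "N (third v) v" "\<not> cadj P (third v) v"
    using third[OF assms(1)] N_sym cadj_sym[of P v] by auto
  then show tt: "third (third v) = v" using third_unique[OF t] by simp
  show "bound (third v)" using bound_iff[OF t] tt assms by simp
  show "third v \<noteq> v" using third[OF assms(1)] irreflN by metis
qed

text \<open>Otherwise a detour through the common component could be inserted between the two
  vertices, lengthening \<open>P\<close>.\<close>

lemma consecutive_not_linked:
  assumes i: "Suc i < length P" "\<not> bound (P ! i)" "\<not> bound (P ! Suc i)"
  shows "(third (P ! i), third (P ! Suc i)) \<notin> linked"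
proof
  assume "(third (P ! i), third (P ! Suc i)) \<in> linked"
  then obtain b where b: "b \<noteq> []" "distinct b" "successively N b" "hd b = third (P ! i)" "last b = third (P ! Suc i)"
    "\<And>w. w \<in> set b \<Longrightarrow> (third (P ! i), w) \<in> linked" by (rule conn_path) blast
  have mem: "P ! i \<in> set P" "P ! Suc i \<in> set P" using i by auto
  have bU: "set b \<subseteq> outer" using conn_in[OF b(6) third_outer[OF mem(1) i(2)]] by blast
  define q where "q = take (Suc i) P @ b @ drop (Suc i) P"
  have TD: "take (Suc i) P @ drop (Suc i) P = P" by simp
  have "last (take (Suc i) P) = P ! i" using i(1) by (simp add: take_Suc_conv_app_nth)
  moreover have "hd (drop (Suc i) P) = P ! Suc i" using i(1) by (simp add: hd_drop_conv_nth)
  moreover have "successively N (take (Suc i) P)" "successively N (drop (Suc i) P)"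
    using P(4) successively_append_iff[of N "take (Suc i) P" "drop (Suc i) P"] by simp_all
  moreover have "N (P ! i) (hd b)" "N (last b) (P ! Suc i)"
    using third[OF mem(1)] third[OF mem(2)] N_sym b(4,5) by auto
  ultimately have "successively N q"
    using b(1,3) i(1) by (auto simp: q_def successively_append_iff)
  moreover have "distinct q"
    using b(2) bU P(2) distinct_append[of "take (Suc i) P" "drop (Suc i) P"]
      in_set_takeD[of _ "Suc i" P] in_set_dropD[of _ "Suc i" P]
    by (auto simp: q_def outer_def)
  moreover have "set q \<subseteq> V"
    using bU P(3) in_set_takeD[of _ "Suc i" P] in_set_dropD[of _ "Suc i" P] by (auto simp: q_def outer_def)
  moreover have "hd q = x" "last q = y"
    using P(1,5,6) i(1) by (auto simp: q_def last_drop hd_append)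
  ultimately have "net_path x y q" using P(1) by (simp add: net_path_def q_def)
  then have "length q \<le> length P" by (rule not_longer)
  then show False using b(1) i(1) by (simp add: q_def)
qed

text \<open>The attachments separate the component from the rest of the graph, so fewer than three
  would contradict 3-connectivity.\<close>

lemma component_attachments:
  assumes v: "v \<in> set P" "\<not> bound v"
  shows "3 \<le> card {u \<in> set P. \<not> bound u \<and> (third v, third u) \<in> linked}"
proof (rule ccontr)
  define C where "C = {w. (third v, w) \<in> linked}"
  define S where "S = {u \<in> set P. \<not> bound u \<and> (third v, third u) \<in> linked}"
  assume "\<not> ?thesis"
  then have S3: "card S < 3" by (simp add: S_def)
  have C_outer: "C \<subseteq> outer" using conn_in[OF _ third_outer[OF v]] by (auto simp: C_def)
  have SP: "S \<subseteq> set P" by (auto simp: S_def)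
  \<comment> \<open>Some vertex of \<open>P\<close> is not an attachment, so there is something to
    be separated from the component.\<close>
  have "card S < card (set P)" using S3 len P(2) by (simp add: distinct_card)
  then have "S \<noteq> set P" by auto
  then obtain p where p: "p \<in> set P" "p \<notin> S" using SP by blast
  have "C \<noteq> V - S" using C_outer p P(3) by (auto simp: outer_def)
  moreover have "C \<noteq> {}" by (auto simp: C_def intro: conn_refl)
  moreover have "S \<subseteq> V" "C \<subseteq> V - S" using C_outer SP P(3) by (auto simp: outer_def)
  ultimately obtain u w where uw: "u \<in> C" "w \<in> V - S - C" "N u w"
    using cut[of S C] S3 by blast
  show False
  proof (cases "w \<in> set P")
    case True
    have "u \<notin> set P" using uw(1) C_outer by (auto simp: outer_def)
    then have "u = third w"
      using third_unique[OF True] N_sym[OF uw(3)] cadj_in_set[of P w u] by blast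
    moreover have "\<not> bound w" using bound_iff[OF True] \<open>u \<notin> set P\<close> calculation by simp
    ultimately have "w \<in> S" using True uw(1) by (simp add: S_def C_def)
    then show False using uw(2) by blast
  next
    case False
    then have "(u, w) \<in> linked" using uw C_outer by (intro conn_step) (auto simp: outer_def)
    then have "w \<in> C" using uw(1) conn_trans by (auto simp: C_def)
    then show False using uw(2) by blast
  qed
qed

text \<open>
  \<open>lo = 0\<close> is the case without chords, \<open>lo = 1\<close> that of a single chord, joining \<open>P ! 0\<close> and \<open>P ! j\<close>.
\<close>

lemma sparse_bound_impossible:
  fixes lo j :: nat
  assumes cases: "lo = 0 \<and> (\<forall>v\<in>set P. \<not> bound v) \<or>
    lo = 1 \<and> Suc j < length P \<and> (\<forall>i<length P. bound (P ! i) \<longleftrightarrow> i = 0 \<or> i = j)"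
  shows False
proof -
  define m where "m = length P - lo"
  define r where "r i = P ! (i + lo)" for i
  define t where "t i = third (r i)" for i
  define free where "free = {i. i < m \<and> \<not> bound (r i)}"
  \<comment> \<open>For \<open>lo = 1\<close>, index \<open>i\<close> of \<open>r\<close> is
    position \<open>Suc i\<close> of \<open>P\<close>, so \<open>F\<close> holds the path neighbours
    of the chord end \<open>j\<close>. A representative there would have a neighbour without a
    component.\<close>
  define F where "F = (if lo = 0 then {} else {i. consec (Suc i) j})"
  define col where "col i = {w. (t i, w) \<in> linked}" for i
  define V0 where "V0 = free - F"
  define K where "K = col ` free"
  have lo1: "lo \<le> 1" using cases by auto
  have m: "2 \<le> m" using len lo1 by (simp add: m_def)
  have r_in: "r i \<in> set P" if "i < m" for i using that by (simp add: r_def m_def)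
  have inj: "inj_on r {..<m}"
    using P(2) by (auto simp: inj_on_def r_def m_def nth_eq_iff_index_eq)
  have fin: "finite free" by (simp add: free_def)
  have free_m: "i < m" if "i \<in> free" for i using that by (simp add: free_def)
  have t: "t i \<in> outer" "N (r i) (t i)" if "i \<in> free" for i
    using third_outer[of "r i"] third[of "r i"] r_in that by (auto simp: free_def t_def)
  have surj: "\<exists>i\<in>free. v = r i" if v: "v \<in> set P" "\<not> bound v" for v
  proof -
    obtain k where k: "k < length P" "v = P ! k" using v(1) by (auto simp: in_set_conv_nth)
    have "lo \<le> k"
    proof (rule ccontr)
      assume "\<not> lo \<le> k"
      then have "lo = 1" "k = 0" using lo1 by auto
      then show False using cases k v(2) by auto
    qed
    then show ?thesis using k v(2) by (intro bexI[of _ "k - lo"]) (auto simp: free_def r_def m_def)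
  qed
  have col_eq: "col i = col k \<longleftrightarrow> (t i, t k) \<in> linked" for i k
  proof
    assume "col i = col k"
    moreover have "t k \<in> col k" by (simp add: col_def conn_refl)
    ultimately have "t k \<in> col i" by simp
    then show "(t i, t k) \<in> linked" by (simp add: col_def)
  next
    assume ik: "(t i, t k) \<in> linked"
    then have ki: "(t k, t i) \<in> linked" by (rule conn_sym[OF symN])
    show "col i = col k"
      using conn_trans[OF ik] conn_trans[OF ki] by (auto simp: col_def)
  qed
  have class3: "3 \<le> card {i \<in> free. col i = B}" if BK: "B \<in> K" for B
  proof -
    obtain k where k: "k \<in> free" "B = col k" using BK by (auto simp: K_def)
    have "{u \<in> set P. \<not> bound u \<and> (third (r k), third u) \<in> linked} \<subseteq> r ` {i \<in> free. col i = B}"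
    proof
      fix u assume u: "u \<in> {u \<in> set P. \<not> bound u \<and> (third (r k), third u) \<in> linked}"
      then obtain i where i: "i \<in> free" "u = r i" using surj by blast
      then have "(t k, t i) \<in> linked" using u by (simp add: t_def)
      then have "col i = B" using col_eq[of k i] k by simp
      then show "u \<in> r ` {i \<in> free. col i = B}" using i by blast
    qed
    then have "card {u \<in> set P. \<not> bound u \<and> (third (r k), third u) \<in> linked} \<le> card (r ` {i \<in> free. col i = B})"
      using fin by (intro card_mono) auto
    also have "\<dots> \<le> card {i \<in> free. col i = B}" using fin by (intro card_image_le) simp
    finally show ?thesis
      using component_attachments[of "r k"] r_in k by (auto simp: free_def)
  qed
  have F: "finite F" "card F \<le> 2"
  proof -
    have sub: "F \<subseteq> {j - 2, j}" by (auto simp: F_def consec_def)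
    then show "finite F" by (rule finite_subset) simp
    have "card F \<le> card {j - 2, j}" using sub by (intro card_mono) auto
    also have "\<dots> \<le> 2" by (simp add: card_insert_if)
    finally show "card F \<le> 2" .
  qed
  \<comment> \<open>Three attachments for each component, less the at most two vertices of
    \<open>F\<close>.\<close>
  have "3 * card I \<le> card {v \<in> V0. col v \<in> I} + 2" if I: "I \<subseteq> K" for I
  proof -
    have finI: "finite I" using I fin by (auto simp: K_def intro: finite_subset)
    have "3 * card I = (\<Sum>B\<in>I. 3)" by simp
    also have "\<dots> \<le> (\<Sum>B\<in>I. card {i \<in> free. col i = B})"
      using class3 I by (intro sum_mono) auto
    also have "\<dots> = card (\<Union>B\<in>I. {i \<in> free. col i = B})"
      using finI fin by (intro card_UN_disjoint[symmetric]) auto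
    also have "(\<Union>B\<in>I. {i \<in> free. col i = B}) = {v \<in> free. col v \<in> I}" by blast
    finally have "3 * card I \<le> card {v \<in> free. col v \<in> I}" .
    moreover have "card {v \<in> free. col v \<in> I} - card F \<le> card ({v \<in> free. col v \<in> I} - F)"
      using F(1) by (rule diff_card_le_card_Diff)
    moreover have "{v \<in> free. col v \<in> I} - F = {v \<in> V0. col v \<in> I}" by (auto simp: V0_def)
    ultimately show ?thesis using F(2) by simp
  qed
  then obtain A where A: "A \<subseteq> V0" "indep A" "bij_betw col A K"
    using independent_transversal_path[of V0 K col] fin by (auto simp: V0_def K_def)
  have A_free: "A \<subseteq> free" using A(1) by (auto simp: V0_def)
  define s where "s i = inv_into A col (col i)" for i
  define T where "T = free - A"
  have s: "s i \<in> A" "col (s i) = col i" if "i \<in> free" for i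
  proof -
    have "col i \<in> col ` A" using A(3) that by (simp add: bij_betw_def K_def)
    then show "s i \<in> A" "col (s i) = col i" by (simp_all add: s_def inv_into_into f_inv_into_f)
  qed
  have not_consec: "\<not> consec i k" if "i \<in> free" "k \<in> free" "col i = col k" for i k
  proof -
    have *: False if "i \<in> free" "Suc i \<in> free" "col i = col (Suc i)" for i
    proof -
      have "Suc (i + lo) < length P" using free_m[OF that(2)] by (simp add: m_def)
      then show False
        using consecutive_not_linked[of "i + lo"] that col_eq[of i "Suc i"]
        by (auto simp: free_def r_def t_def)
    qed
    then show ?thesis using that *[of i] *[of k] by (auto simp: consec_def)
  qed
  \<comment> \<open>The end \<open>y\<close> is not bound, so there is at least one component and
    \<open>A\<close> is not empty.\<close>
  have last_free: "m - 1 \<in> free"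
  proof -
    have "m - 1 + lo = length P - 1" using m by (simp add: m_def)
    moreover have "\<not> bound (P ! (length P - 1))"
      using cases len by (auto simp: P(1) last_conv_nth[symmetric])
    ultimately show ?thesis using m by (simp add: free_def r_def)
  qed
  obtain W where W: "W \<noteq> []" "distinct W" "successively N W" "hd W = r 0" "last W = r (m - 1)"
    "set W \<subseteq> r ` {..<m} \<union> outer" "m < length W"
  proof (rule longer_path_from_star_path[of N m r A T s outer t])
    show "N (r i) (r (Suc i))" if "Suc i < m" for i
      using successively_nth[OF P(4), of "i + lo"] that by (simp add: r_def m_def)
    show "A \<subseteq> {..<m}" "T \<subseteq> {..<m}" "A \<inter> T = {}" using A_free free_m by (auto simp: T_def)
    show "A \<noteq> {}" using s(1)[OF last_free] by blast
    show "Suc a \<notin> A" if "a \<in> A" for a using A(2) that by (simp add: indep_def)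
    show "s i \<in> A \<and> \<not> consec i (s i)" if "i \<in> T" for i
      using that s[of i] not_consec[of i "s i"] A_free by (auto simp: T_def)
    show "r i \<notin> outer" if "i < m" for i using r_in[OF that] by (simp add: outer_def)
    show "t i \<in> outer \<and> N (r i) (t i)" if "i \<in> A \<union> T" for i
      using that t A_free by (auto simp: T_def)
    show "(t (s i), t i) \<in> linked" if "i \<in> T" for i
      using that s[of i] col_eq[of "s i" i] by (simp add: T_def)
    show "(t a, t b) \<notin> linked" if "a \<in> A" "b \<in> A" "a \<noteq> b" for a b
      using that A(3) col_eq[of a b] by (auto simp: bij_betw_def inj_on_def)
    show "i \<in> T" if a: "a \<in> A" and i: "i < m" "consec a i" for a i
    proof -
      have "i \<notin> A" using A(2) a i(2) by (auto simp: indep_def consec_def)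
      \<comment> \<open>A bound neighbour could only be \<open>P ! 0\<close>, which has been
        dropped, or \<open>P ! j\<close>, whose neighbours are in \<open>F\<close>.\<close>
      moreover have "i \<in> free"
      proof (cases "lo = 0")
        case True
        then show ?thesis using cases i(1) r_in[OF i(1)] by (auto simp: free_def)
      next
        case False
        then have lo: "lo = 1" "\<forall>i<length P. bound (P ! i) \<longleftrightarrow> i = 0 \<or> i = j" using cases by auto
        have "a \<notin> F" using a A(1) by (auto simp: V0_def)
        then have "\<not> consec (Suc a) j" using False by (simp add: F_def)
        then have "Suc i \<noteq> j" using i(2) by (auto simp: consec_def)
        then show ?thesis using lo i(1) by (simp add: free_def r_def m_def)
      qed
      ultimately show ?thesis by (simp add: T_def)
    qed
  qed (use symN m inj in auto)
  have WV: "set W \<subseteq> V" using W(6) r_in P(3) by (auto simp: outer_def)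
  have last: "last W = y"
  proof -
    have "m - 1 + lo = length P - 1" using m by (simp add: m_def)
    then show ?thesis using W(5) P(1,6) by (simp add: r_def last_conv_nth)
  qed
  show False
  proof (cases "lo = 0")
    case True
    then have "net_path x y W" using W P(1,5) WV last by (simp add: net_path_def r_def hd_conv_nth)
    then show False using not_longer[of W] W(7) True by (simp add: m_def)
  next
    case False
    then have lo: "lo = 1" using lo1 by simp
    have x: "x = P ! 0" using P(1,5) by (simp add: hd_conv_nth)
    \<comment> \<open>The longer path starts at the second vertex of \<open>P\<close>, so
      \<open>x\<close> can be put back in front.\<close>
    have "x \<notin> r ` {..<m}"
    proof
      assume "x \<in> r ` {..<m}"
      then obtain i where i: "i < m" "P ! 0 = P ! Suc i" by (auto simp: x r_def lo)
      moreover have "0 < length P" "Suc i < length P" using i(1) by (auto simp: m_def lo)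
      ultimately show False using nth_eq_iff_index_eq[OF P(2), of 0 "Suc i"] by simp
    qed
    moreover have "x \<notin> outer" using P(1) x by (simp add: outer_def)
    ultimately have "x \<notin> set W" using W(6) by blast
    moreover have "N x (hd W)"
      using successively_nth[OF P(4), of 0] len by (simp add: W(4) r_def lo x)
    moreover have "x \<in> V" using xy N_in by blast
    ultimately have "net_path x y (x # W)"
      using W WV last by (cases W) (auto simp: net_path_def)
    then show False using not_longer[of "x # W"] W(7) lo by (simp add: m_def)
  qed
qed

lemma chord_impossible:
  assumes "v \<in> set P" "v \<noteq> y" "{u \<in> set P. bound u} = {x, v}"
  shows False
proof -
  obtain j where j: "j < length P" "v = P ! j" using assms(1) by (auto simp: in_set_conv_nth)
  have "j \<noteq> length P - 1" using assms(2) j(2) P(1,6) by (auto simp: last_conv_nth)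
  moreover have "bound (P ! i) \<longleftrightarrow> i = 0 \<or> i = j" if "i < length P" for i
  proof -
    have "bound (P ! i) \<longleftrightarrow> P ! i \<in> {u \<in> set P. bound u}" using that by simp
    also have "\<dots> \<longleftrightarrow> P ! i = P ! 0 \<or> P ! i = P ! j"
      using assms(3) P(1,5) j(2) by (simp add: hd_conv_nth)
    also have "\<dots> \<longleftrightarrow> i = 0 \<or> i = j"
      using that j(1) P(1,2) by (simp add: nth_eq_iff_index_eq)
    finally show ?thesis .
  qed
  moreover have "Suc j < length P" using \<open>j \<noteq> length P - 1\<close> j(1) by linarith
  ultimately show False using sparse_bound_impossible[of 1 j] by auto
qed

text \<open>Chords pair up the bound vertices and never join \<open>x\<close> to \<open>y\<close>,
  since that edge lies on the cycle. So some internal vertex is bound; if it is the only one, its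
  partner is an end of \<open>P\<close>, and the other end is not bound, as its partner would have
  to be the same internal vertex.\<close>

theorem two_internal_bound: "2 \<le> card {v \<in> set P - {x, y}. bound v}"
proof (rule ccontr)
  \<comment> \<open>A chord at \<open>y\<close> is a chord at the first vertex of the reversed
    path.\<close>
  interpret R: longest_net_path V N y x "rev P"
    by unfold_locales (use longest longest_rev xy N_sym in auto)
  have R_bound: "R.bound = bound" by (simp add: fun_eq_iff bound_def R.bound_def)
  define B where "B = {v \<in> set P. bound v}"
  assume "\<not> ?thesis"
  moreover have "{v \<in> set P - {x, y}. bound v} = B - {x, y}" by (auto simp: B_def)
  ultimately have card1: "card (B - {x, y}) \<le> 1" by simp
  have fin: "finite (B - {x, y})" by (simp add: B_def)
  have xyP: "x \<in> set P" "y \<in> set P" using P(1,5,6) hd_in_set last_in_set by blast+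
  have third_B: "third v \<in> B" "third (third v) = v" "third v \<noteq> v" if "v \<in> B" for v
    using that third_third by (auto simp: B_def)
  have "cadj P y x" using cadj_ends[OF P(1)] P(5,6) by simp
  then have third_xy: "third x \<noteq> y" "third y \<noteq> x"
    using third[OF xyP(1)] third[OF xyP(2)] cadj_sym[of P x y] by auto
  have "B \<noteq> {}" using sparse_bound_impossible[of 0] by (auto simp: B_def)
  then obtain v where v: "v \<in> B" by blast
  have "\<exists>w. w \<in> B - {x, y}"
  proof (cases "v \<in> {x, y}")
    case True
    then have "third v \<in> B - {x, y}" using third_B[OF v] third_xy by auto
    then show ?thesis by blast
  qed (use v in blast)
  then obtain w where w: "w \<in> B - {x, y}" by blast
  have only: "u = w" if "u \<in> B - {x, y}" for u
    using card1 fin w that by (metis One_nat_def card_le_Suc0_iff_eq)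
  have tw: "third w \<in> {x, y}"
    using third_B[of w] w only[of "third w"] by blast
  then consider "third w = x" | "third w = y" by blast
  then show False
  proof cases
    case 1
    have "y \<notin> B"
    proof
      assume "y \<in> B"
      then have "third y \<in> B - {x, y}" using third_B[of y] third_xy by blast
      then have "third y = w" by (rule only)
      then have "y = x" using third_B(2)[OF \<open>y \<in> B\<close>] 1 by simp
      then show False using xy irreflN by blast
    qed
    moreover have "x \<in> B" using third_B(1)[of w] w 1 by auto
    ultimately have "B = {x, w}" using only w by blast
    then show False using chord_impossible[of w] w by (auto simp: B_def)
  next
    case 2
    have "x \<notin> B"
    proof
      assume "x \<in> B"
      then have "third x \<in> B - {x, y}" using third_B[of x] third_xy by blast
      then have "third x = w" by (rule only)
      then have "x = y" using third_B(2)[OF \<open>x \<in> B\<close>] 2 by simp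
      then show False using xy irreflN by blast
    qed
    moreover have "y \<in> B" using third_B(1)[of w] w 2 by auto
    ultimately have "B = {y, w}" using only w by blast
    then show False using R.chord_impossible[of w] w by (auto simp: B_def R_bound)
  qed
qed

end

section \<open>Translation from symmetric digraphs\<close>

lemma cubic_net_graph:
  assumes "graph G" "k_connected 3 G" "cubic G"
  shows "cubic_net (verts G) (\<lambda>u v. u \<rightarrow>\<^bsub>G\<^esub> v)"
proof -
  interpret graph G by fact
  show ?thesis
  proof
    show "finite (verts G)" by simp
    show "3 < card (verts G)" using assms(2) by (simp add: k_connected_def)
    show "symp (\<lambda>u v. u \<rightarrow>\<^bsub>G\<^esub> v)"
      using arcs_ends_symmetric[OF sym_arcs] by (auto simp: symp_def)
    show "\<not> v \<rightarrow>\<^bsub>G\<^esub> v" for v using no_loops by (auto simp: arcs_ends_conv)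
    show "u \<in> verts G" if "u \<rightarrow>\<^bsub>G\<^esub> v" for u v using that by (rule adj_in_verts)
    show "card {u. v \<rightarrow>\<^bsub>G\<^esub> u} = 3" if "v \<in> verts G" for v
    proof -
      have "{u. v \<rightarrow>\<^bsub>G\<^esub> u} = head G ` out_arcs G v"
        by (auto simp: arcs_ends_conv)
      moreover have "inj_on (head G) (out_arcs G v)"
        by (auto simp: inj_on_def arc_to_ends_def intro: no_multi_arcs)
      ultimately have "card {u. v \<rightarrow>\<^bsub>G\<^esub> u} = out_degree G v"
        by (simp add: card_image out_degree_def)
      then show ?thesis using assms(3) that by (simp add: cubic_def)
    qed
    show "\<exists>u\<in>C. \<exists>v\<in>verts G - S - C. u \<rightarrow>\<^bsub>G\<^esub> v"
      if SC: "S \<subseteq> verts G" "card S < 3" "C \<subseteq> verts G - S" "C \<noteq> {}" "C \<noteq> verts G - S" for S C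
    proof (rule ccontr)
      assume none: "\<not> ?thesis"
      let ?H = "G \<restriction> (verts G - S)"
      obtain a b where ab: "a \<in> C" "b \<in> verts G - S - C" using SC(3-5) by blast
      have "connected ?H" using assms(2) SC(1,2) by (simp add: k_connected_def)
      then have "(a, b) \<in> rtrancl_on (verts G - S) ((arcs_ends ?H)\<^sup>s)"
        using ab SC(3) unfolding connected_conv by auto
      \<comment> \<open>With no edge leaving \<open>C\<close>, reachability from \<open>a\<close>
        stays in \<open>C\<close>.\<close>
      then have "b \<in> C"
      proof (induction rule: rtrancl_on_induct)
        case base
        then show ?case using ab by simp
      next
        case (step u v)
        have "u \<rightarrow>\<^bsub>G\<^esub> v \<or> v \<rightarrow>\<^bsub>G\<^esub> u"
          using step(2) by (auto simp: symcl_def arcs_ends_conv induce_subgraph_def)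
        then have "u \<rightarrow>\<^bsub>G\<^esub> v" using arcs_ends_symmetric[OF sym_arcs] by blast
        then show ?case using none step by blast
      qed
      then show False using ab by blast
    qed
  qed
qed

lemma set_vwalk_arcs_iff_successively:
  "(\<forall>u v. (u, v) \<in> set (vwalk_arcs p) \<longrightarrow> R u v) \<longleftrightarrow> successively R p"
  by (induction p rule: vwalk_arcs.induct) auto

theorem theorem1p6:
  fixes G :: "('a,'b) pre_digraph" and x y :: 'a and P :: "'a vwalk"
  assumes "graph G"
    and "k_connected 3 G"
    and "cubic G"
    and "x \<in> verts G" and "y \<in> verts G" and "x \<noteq> y"
    and "x \<rightarrow>\<^bsub>G\<^esub> y"
    and "longest_path_between G x y P"
  shows "card {v \<in> internal_verts P. bound_vertex G (path_subgraph G P) v} \<ge> 2"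
proof -
  interpret cubic_net "verts G" "\<lambda>u v. u \<rightarrow>\<^bsub>G\<^esub> v"
    using assms(1-3) by (rule cubic_net_graph)
  have path_iff: "path_between G u v q \<longleftrightarrow> net_path u v q" for u v q
  proof -
    have "set (vwalk_arcs q) \<subseteq> arcs_ends G \<longleftrightarrow> successively (\<lambda>u v. u \<rightarrow>\<^bsub>G\<^esub> v) q"
      using set_vwalk_arcs_iff_successively[of q "\<lambda>u v. u \<rightarrow>\<^bsub>G\<^esub> v"] by auto
    then show ?thesis
      by (auto simp: path_between_def net_path_def vpath_def vwalk_def)
  qed
  have len: "length q \<le> length P" if "net_path x y q" for q
  proof -
    \<comment> \<open>\<open>vwalk_length\<close> counts edges; since \<open>P\<close> is nonempty,
      truncated subtraction does no harm.\<close>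
    have "length q - 1 \<le> length P - 1" "P \<noteq> []"
      using that assms(8) by (auto simp: longest_path_between_def path_iff net_path_def)
    then show ?thesis by (cases P) auto
  qed
  interpret longest_net_path "verts G" "\<lambda>u v. u \<rightarrow>\<^bsub>G\<^esub> v" x y P
  proof
    show "longest x y P"
      using assms(8) len by (simp add: longest_def longest_path_between_def path_iff)
    show "x \<rightarrow>\<^bsub>G\<^esub> y" by fact
  qed
  have "{v \<in> internal_verts P. bound_vertex G (path_subgraph G P) v} = {v \<in> set P - {x, y}. bound v}"
    using P(5,6) by (auto simp: internal_verts_def bound_vertex_def path_subgraph_def nbrs_def bound_def)
  then show ?thesis using two_internal_bound by simp
qed

end
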